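(* Let $(\mathsf{A},\Delta)$ be a compact quantum group with dense Hopf $*$-algebra $\mathcal{A}$, Haar state $h$, antipode $S$ and unitary antipode $R$. Let $(T_t)_{t\ge0}$ be the Markov semigroup of a Lévy process on $\mathcal{A}$ with generating functional $\phi$, and let $L_\phi=(\mathrm{id}\otimes\phi)\circ\Delta:\mathcal{A}\to\mathcal{A}$. (a) The following three conditions are equivalent: (a1) $\phi$ is KMS-symmetric, i.e. $\phi\circ R=\phi$; (a2) $L_\phi$ is KMS-symmetric, i.e. $h\big(\sigma_{-i/2}(a)^*L_\phi(b)\big)=h\big(L_\phi(a)^*\sigma_{-i/2}(b)\big)$ for all $a,b\in\mathcal{A}$; (a3) for each $t\ge0$, $T_t$ is KMS-symmetric on $\mathsf{A}$, i.e. $h\big(aT_t(b)\big)=h\big(\sigma_{i/2}(b)T_t(\sigma_{-i/2}(a))\big)$ for all $a,b$ in a dense $\sigma$-invariant $*$-subalgebra of $\mathsf{A}$. (b) The following four conditions are equivalent: (b1) $\phi$ is GNS-symmetric, i.e. $\phi\circ S=\phi$; (b2) $L_\phi$ is GNS-symmetric, i.e. $h\big(a^*L_\phi(b)\big)=h\big(L_\phi(a)^*b\big)$ for all $a,b\in\mathcal{A}$; (b2') $L_\phi$ satisfies the quantum detailed balance condition $h\big(aL_\phi(b)\big)=h\big(L_\phi(a)b\big)$ for all $a,b\in\mathcal{A}$; (b3) $(T_t)_{t\ge0}$ satisfies the quantum detailed balance condition, i.e. $h\big(aT_t(b)\big)=h\big(T_t(a)b\big)$ for all $a,b\in\mathcal{A}$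 and all $t\ge0$.
   Context: A compact quantum group is a pair $(\mathsf{A},\Delta)$ with $\mathsf{A}$ a unital $C^*$-algebra and $\Delta:\mathsf{A}\to\mathsf{A}\otimes\mathsf{A}$ a coassociative unital $*$-homomorphism such that the linear spans of $(1\otimes\mathsf{A})\Delta(\mathsf{A})$ and $(\mathsf{A}\otimes 1)\Delta(\mathsf{A})$ are dense in $\mathsf{A}\otimes\mathsf{A}$. $\mathcal{A}\subseteq\mathsf{A}$ is the dense Hopf $*$-algebra spanned by coefficients of finite-dimensional unitary corepresentations, with counit $\varepsilon$ and antipode $S$. $h$ is the Haar state (the unique state with $(h\otimes\mathrm{id})\Delta(a)=h(a)1=(\mathrm{id}\otimes h)\Delta(a)$). For $\lambda,\mu\in\mathcal{A}'$ (all linear functionals on $\mathcal{A}$) and $a\in\mathcal{A}$: $\lambda\star\mu=(\lambda\otimes\mu)\circ\Delta$, $\lambda\star a=(\mathrm{id}\otimes\lambda)\Delta(a)$, $a\star\lambda=(\lambda\otimes\mathrm{id})\Delta(a)$. Woronowicz characters: $(f_z)_{z\in\mathbb{C}}$ is the unique family of multiplicative linear functionals on $\mathcal{A}$ with $f_z(1)=1$, $z\mapsto f_z(a)$ entire, $f_0=\varepsilon$, $f_{z_1}\star f_{z_2}=f_{z_1+z_2}$, $f_z(S(a))=f_{-z}(a)$, $f_{\bar z}(a^* )=\overline{f_{-z}(a)}$, $S^2(a)=f_{-1}\star a\star f_1$, and $h(ab)=h(b(f_1\star a\star f_1))$. The modular group is $\sigma_z(a)=f_{iz}\star a\star f_{iz}$,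 so $h(ab)=h(b\sigma_{-i}(a))$. The unitary antipode is $R(a)=S(f_{1/2}\star a\star f_{-1/2})$, $a\in\mathcal{A}$. A generating functional of a Lévy process on $\mathcal{A}$ is a linear $\phi:\mathcal{A}\to\mathbb{C}$ that is hermitian ($\phi(a^* )=\overline{\phi(a)}$), satisfies $\phi(1)=0$, and is conditionally positive ($\phi(a^*a)\ge0$ for $a\in\ker\varepsilon$). The associated convolution semigroup of states is $\varphi_t=\exp_\star(t\phi)=\varepsilon+t\phi+\frac{t^2}{2}\phi\star\phi+\cdots$, and the Markov semigroup on $\mathcal{A}$ is $T_t=(\mathrm{id}\otimes\varphi_t)\circ\Delta=\exp(tL_\phi)$; it extends uniquely to a strongly continuous semigroup of unital completely positive contractions on the $C^*$-algebra $\mathsf{A}$ (taken to be the reduced or the universal $C^*$-algebra of $\mathcal{A}$), also denoted $(T_t)$. *)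

theory Defs
  imports "HOL-Analysis.Analysis"
begin

section \<open>Unital C*-algebras\<close>

class unital_cstar_algebra = real_normed_algebra_1 + banach +
  fixes scaleC :: "complex \<Rightarrow> 'a \<Rightarrow> 'a" (infixr "*\<^sub>C" 75)
    and star :: "'a \<Rightarrow> 'a"
  assumes scaleC_add_right: "c *\<^sub>C (x + y) = c *\<^sub>C x + c *\<^sub>C y"
    and scaleC_add_left: "(c + d) *\<^sub>C x = c *\<^sub>C x + d *\<^sub>C x"
    and scaleC_scaleC: "c *\<^sub>C d *\<^sub>C x = (c * d) *\<^sub>C x"
    and scaleC_of_real: "complex_of_real r *\<^sub>C x = r *\<^sub>R x"
    and scaleC_mult_left: "(c *\<^sub>C x) * y = c *\<^sub>C (x * y)"
    and scaleC_mult_right: "x * (c *\<^sub>C y) = c *\<^sub>C (x * y)"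
    and norm_scaleC: "norm (c *\<^sub>C x) = cmod c * norm x"
    and star_star: "star (star x) = x"
    and star_add: "star (x + y) = star x + star y"
    and star_scaleC: "star (c *\<^sub>C x) = cnj c *\<^sub>C star x"
    and star_mult: "star (x * y) = star y * star x"
    and cstar_identity: "norm (star x * x) = (norm x)\<^sup>2"

instantiation complex :: unital_cstar_algebra
begin

definition scaleC_complex_def: "c *\<^sub>C (z::complex) = c * z"
definition star_complex_def: "star (z::complex) = cnj z"

instance
  by standard
    (simp_all add: scaleC_complex_def star_complex_def algebra_simps scaleR_conv_of_real
      norm_mult power2_eq_square)

end

abbreviation cspan :: "'a::unital_cstar_algebra set \<Rightarrow> 'a set"
  where "cspan \<equiv> module.span scaleC"

abbreviation cdependent :: "'a::unital_cstar_algebra set \<Rightarrow> bool"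
  where "cdependent \<equiv> module.dependent scaleC"

definition clinear_on ::
    "'a::unital_cstar_algebra set \<Rightarrow> ('a \<Rightarrow> 'b::unital_cstar_algebra) \<Rightarrow> bool" where
  "clinear_on V f \<longleftrightarrow>
     (\<forall>x\<in>V. \<forall>y\<in>V. f (x + y) = f x + f y) \<and> (\<forall>c. \<forall>x\<in>V. f (c *\<^sub>C x) = c *\<^sub>C f x)"

definition unital_star_hom :: "('a::unital_cstar_algebra \<Rightarrow> 'b::unital_cstar_algebra) \<Rightarrow> bool" where
  "unital_star_hom f \<longleftrightarrow> clinear_on UNIV f \<and> f 1 = 1 \<and>
     (\<forall>x y. f (x * y) = f x * f y) \<and> (\<forall>x. f (star x) = star (f x))"

definition star_subalgebra :: "'a::unital_cstar_algebra set \<Rightarrow> bool" where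
  "star_subalgebra B \<longleftrightarrow> 0 \<in> B \<and> (\<forall>x\<in>B. \<forall>y\<in>B. x + y \<in> B \<and> x * y \<in> B) \<and>
     (\<forall>c. \<forall>x\<in>B. c *\<^sub>C x \<in> B) \<and> (\<forall>x\<in>B. star x \<in> B)"

definition cstar_seminorm_on :: "'a::unital_cstar_algebra set \<Rightarrow> ('a \<Rightarrow> real) \<Rightarrow> bool" where
  "cstar_seminorm_on X p \<longleftrightarrow>
     (\<forall>x\<in>X. \<forall>y\<in>X. p (x + y) \<le> p x + p y \<and> p (x * y) \<le> p x * p y) \<and>
     (\<forall>c. \<forall>x\<in>X. p (c *\<^sub>C x) = cmod c * p x) \<and>
     (\<forall>x\<in>X. p (star x * x) = (p x)\<^sup>2)"

definition cstar_norm_on :: "'a::unital_cstar_algebra set \<Rightarrow> ('a \<Rightarrow> real) \<Rightarrow> bool" where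
  "cstar_norm_on X p \<longleftrightarrow> cstar_seminorm_on X p \<and> (\<forall>x\<in>X. p x = 0 \<longrightarrow> x = 0)"

definition state :: "('a::unital_cstar_algebra \<Rightarrow> complex) \<Rightarrow> bool" where
  "state \<omega> \<longleftrightarrow> clinear_on UNIV \<omega> \<and> bounded_linear \<omega> \<and> \<omega> 1 = 1 \<and>
     (\<forall>x. \<omega> (star x * x) \<in> \<real>\<^sub>\<ge>\<^sub>0)"

text \<open>Positivity of all amplifications: the positive elements of the algebra of n by n matrices
  are the matrices of the form \<open>y\<^sup>* y\<close>.\<close>

definition completely_positive ::
    "('a::unital_cstar_algebra \<Rightarrow> 'b::unital_cstar_algebra) \<Rightarrow> bool" where
  "completely_positive P \<longleftrightarrow> clinear_on UNIV P \<and>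
     (\<forall>(n::nat) (y :: nat \<Rightarrow> nat \<Rightarrow> 'a). \<exists>z :: nat \<Rightarrow> nat \<Rightarrow> 'b. \<forall>i<n. \<forall>j<n.
        P (\<Sum>k<n. star (y k i) * y k j) = (\<Sum>k<n. star (z k i) * z k j))"

definition entire_curve :: "(complex \<Rightarrow> 'a::unital_cstar_algebra) \<Rightarrow> bool" where
  "entire_curve F \<longleftrightarrow>
     (\<forall>z. \<exists>D. ((\<lambda>w. inverse (w - z) *\<^sub>C (F w - F z)) \<longlongrightarrow> D) (at z))"


section \<open>The minimal tensor product\<close>

text \<open>\<open>t\<close> exhibits its target as the minimal C*-tensor product of \<open>'a\<close> and \<open>'b\<close>: the fourth
  conjunct says that the algebraic tensor product embeds (so that the complex span of the
  elementary tensors is a copy of it), the fifth that it is dense, and the last one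
  that the norm restricts to the least C*-norm on it.\<close>

definition min_tensor_product ::
    "('a::unital_cstar_algebra \<Rightarrow> 'b::unital_cstar_algebra \<Rightarrow> 'c::unital_cstar_algebra) \<Rightarrow> bool"
  where
  "min_tensor_product t \<longleftrightarrow>
     (\<forall>b. clinear_on UNIV (\<lambda>a. t a b)) \<and> (\<forall>a. clinear_on UNIV (t a)) \<and>
     (t 1 1 = 1 \<and> (\<forall>a b a' b'. t a b * t a' b' = t (a * a') (b * b')) \<and>
        (\<forall>a b. star (t a b) = t (star a) (star b))) \<and>
     (\<forall>X w. finite X \<and> \<not> cdependent X \<and> (\<Sum>x\<in>X. t x (w x)) = 0 \<longrightarrow> (\<forall>x\<in>X. w x = 0)) \<and>
     closure (cspan {t a b | a b. True}) = UNIV \<and>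
     (\<forall>p. cstar_norm_on (cspan {t a b | a b. True}) p \<longrightarrow>
        (\<forall>z \<in> cspan {t a b | a b. True}. norm z \<le> p z))"


section \<open>Compact quantum groups\<close>

text \<open>The type \<open>'c\<close> plays the role of \<open>A \<otimes> A\<close> and \<open>'d\<close> that of \<open>A \<otimes> A \<otimes> A\<close>, which is
  presented both as \<open>(A \<otimes> A) \<otimes> A\<close> and as \<open>A \<otimes> (A \<otimes> A)\<close>.\<close>

record ('a, 'c, 'd) quantum_group =
  tens :: "'a \<Rightarrow> 'a \<Rightarrow> 'c"
  tensL :: "'c \<Rightarrow> 'a \<Rightarrow> 'd"
  tensR :: "'a \<Rightarrow> 'c \<Rightarrow> 'd"
  comult :: "'a \<Rightarrow> 'c"

text \<open>\<open>D1\<close> and \<open>D2\<close> are the maps \<open>\<Delta> \<otimes> id\<close> and \<open>id \<otimes> \<Delta>\<close> on \<open>A \<otimes> A\<close>.\<close>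

definition compact_quantum_group ::
    "('a::unital_cstar_algebra, 'c::unital_cstar_algebra, 'd::unital_cstar_algebra) quantum_group
     \<Rightarrow> bool" where
  "compact_quantum_group G \<longleftrightarrow>
     min_tensor_product (tens G) \<and> min_tensor_product (tensL G) \<and> min_tensor_product (tensR G) \<and>
     (\<forall>a b c. tensL G (tens G a b) c = tensR G a (tens G b c)) \<and>
     unital_star_hom (comult G) \<and>
     (\<exists>D1 D2. unital_star_hom D1 \<and> (\<forall>a b. D1 (tens G a b) = tensL G (comult G a) b) \<and>
        unital_star_hom D2 \<and> (\<forall>a b. D2 (tens G a b) = tensR G a (comult G b)) \<and>
        (\<forall>a. D1 (comult G a) = D2 (comult G a))) \<and>
     closure (cspan {tens G 1 a * comult G b | a b. True}) = UNIV \<and>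
     closure (cspan {tens G a 1 * comult G b | a b. True}) = UNIV"

definition unitary_corep ::
    "('a::unital_cstar_algebra, 'c::unital_cstar_algebra, 'd::unital_cstar_algebra) quantum_group
     \<Rightarrow> nat \<Rightarrow> (nat \<Rightarrow> nat \<Rightarrow> 'a) \<Rightarrow> bool" where
  "unitary_corep G n u \<longleftrightarrow> (\<forall>i<n. \<forall>j<n.
     (\<Sum>k<n. star (u k i) * u k j) = (if i = j then 1 else 0) \<and>
     (\<Sum>k<n. u i k * star (u j k)) = (if i = j then 1 else 0) \<and>
     comult G (u i j) = (\<Sum>k<n. tens G (u i k) (u k j)))"

definition hopf_alg ::
    "('a::unital_cstar_algebra, 'c::unital_cstar_algebra, 'd::unital_cstar_algebra) quantum_group
     \<Rightarrow> 'a set" where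
  "hopf_alg G = cspan {u i j | n u i j. unitary_corep G n u \<and> i < n \<and> j < n}"

text \<open>For a map \<open>B\<close> that is bilinear on \<open>hopf_alg G\<close>, \<open>tlift G B\<close> is the linear map
  \<open>x \<otimes> y \<mapsto> B x y\<close> on the algebraic tensor square of \<open>hopf_alg G\<close>, which contains the
  comultiplications of the elements of \<open>hopf_alg G\<close>. The functionals it is applied to below need
  not be bounded, and their values outside \<open>hopf_alg G\<close> do not matter.\<close>

definition tlift ::
    "('a::unital_cstar_algebra, 'c::unital_cstar_algebra, 'd::unital_cstar_algebra) quantum_group
     \<Rightarrow> ('a \<Rightarrow> 'a \<Rightarrow> 'v::comm_monoid_add) \<Rightarrow> 'c \<Rightarrow> 'v" where
  "tlift G B z = (THE v. \<exists>(n::nat) x y.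
     (\<forall>i<n. x i \<in> hopf_alg G \<and> y i \<in> hopf_alg G) \<and>
     z = (\<Sum>i<n. tens G (x i) (y i)) \<and> v = (\<Sum>i<n. B (x i) (y i)))"

text \<open>\<open>conv G \<mu> \<nu> = \<mu> \<star> \<nu>\<close>, \<open>lconv G \<mu> a = \<mu> \<star> a = (id \<otimes> \<mu>) (\<Delta> a)\<close> and
  \<open>rconv G a \<mu> = a \<star> \<mu> = (\<mu> \<otimes> id) (\<Delta> a)\<close>.\<close>

definition conv ::
    "('a::unital_cstar_algebra, 'c::unital_cstar_algebra, 'd::unital_cstar_algebra) quantum_group
     \<Rightarrow> ('a \<Rightarrow> complex) \<Rightarrow> ('a \<Rightarrow> complex) \<Rightarrow> 'a \<Rightarrow> complex" where
  "conv G \<mu> \<nu> a = tlift G (\<lambda>x y. \<mu> x * \<nu> y) (comult G a)"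

definition lconv ::
    "('a::unital_cstar_algebra, 'c::unital_cstar_algebra, 'd::unital_cstar_algebra) quantum_group
     \<Rightarrow> ('a \<Rightarrow> complex) \<Rightarrow> 'a \<Rightarrow> 'a" where
  "lconv G \<mu> a = tlift G (\<lambda>x y. \<mu> y *\<^sub>C x) (comult G a)"

definition rconv ::
    "('a::unital_cstar_algebra, 'c::unital_cstar_algebra, 'd::unital_cstar_algebra) quantum_group
     \<Rightarrow> 'a \<Rightarrow> ('a \<Rightarrow> complex) \<Rightarrow> 'a" where
  "rconv G a \<mu> = tlift G (\<lambda>x y. \<mu> x *\<^sub>C y) (comult G a)"

definition is_counit ::
    "('a::unital_cstar_algebra, 'c::unital_cstar_algebra, 'd::unital_cstar_algebra) quantum_group
     \<Rightarrow> ('a \<Rightarrow> complex) \<Rightarrow> bool" where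
  "is_counit G \<epsilon> \<longleftrightarrow> clinear_on (hopf_alg G) \<epsilon> \<and> \<epsilon> 1 = 1 \<and>
     (\<forall>a\<in>hopf_alg G. \<forall>b\<in>hopf_alg G. \<epsilon> (a * b) = \<epsilon> a * \<epsilon> b) \<and>
     (\<forall>a\<in>hopf_alg G. lconv G \<epsilon> a = a \<and> rconv G a \<epsilon> = a)"

definition is_antipode ::
    "('a::unital_cstar_algebra, 'c::unital_cstar_algebra, 'd::unital_cstar_algebra) quantum_group
     \<Rightarrow> ('a \<Rightarrow> complex) \<Rightarrow> ('a \<Rightarrow> 'a) \<Rightarrow> bool" where
  "is_antipode G \<epsilon> S \<longleftrightarrow> clinear_on (hopf_alg G) S \<and> S ` hopf_alg G \<subseteq> hopf_alg G \<and>
     (\<forall>a\<in>hopf_alg G. tlift G (\<lambda>x y. S x * y) (comult G a) = \<epsilon> a *\<^sub>C 1 \<and>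
                     tlift G (\<lambda>x y. x * S y) (comult G a) = \<epsilon> a *\<^sub>C 1)"

text \<open>\<open>E1\<close> and \<open>E2\<close> are the slice maps \<open>h \<otimes> id\<close> and \<open>id \<otimes> h\<close> on the C*-algebra \<open>A \<otimes> A\<close>.\<close>

definition haar_state ::
    "('a::unital_cstar_algebra, 'c::unital_cstar_algebra, 'd::unital_cstar_algebra) quantum_group
     \<Rightarrow> ('a \<Rightarrow> complex) \<Rightarrow> bool" where
  "haar_state G h \<longleftrightarrow> state h \<and>
     (\<exists>E1 E2. bounded_linear E1 \<and> (\<forall>a b. E1 (tens G a b) = h a *\<^sub>C b) \<and>
        bounded_linear E2 \<and> (\<forall>a b. E2 (tens G a b) = h b *\<^sub>C a) \<and>
        (\<forall>a. E1 (comult G a) = h a *\<^sub>C 1 \<and> E2 (comult G a) = h a *\<^sub>C 1))"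

definition is_reduced_cstar ::
    "('a::unital_cstar_algebra, 'c::unital_cstar_algebra, 'd::unital_cstar_algebra) quantum_group
     \<Rightarrow> ('a \<Rightarrow> complex) \<Rightarrow> bool" where
  \<comment> \<open>completion of \<open>hopf_alg G\<close> in the operator norm of its left multiplication on \<open>L\<^sup>2(h)\<close>\<close>
  "is_reduced_cstar G h \<longleftrightarrow> closure (hopf_alg G) = UNIV \<and>
     (let n2 = (\<lambda>b. sqrt (Re (h (star b * b)))) in
      \<forall>a\<in>hopf_alg G. (\<forall>b\<in>hopf_alg G. n2 (a * b) \<le> norm a * n2 b) \<and>
        (\<forall>C\<ge>0. (\<forall>b\<in>hopf_alg G. n2 (a * b) \<le> C * n2 b) \<longrightarrow> norm a \<le> C))"

definition is_universal_cstar ::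
    "('a::unital_cstar_algebra, 'c::unital_cstar_algebra, 'd::unital_cstar_algebra) quantum_group
     \<Rightarrow> bool" where
  \<comment> \<open>completion of \<open>hopf_alg G\<close> in its greatest C*-seminorm\<close>
  "is_universal_cstar G \<longleftrightarrow> closure (hopf_alg G) = UNIV \<and>
     (\<forall>p. cstar_seminorm_on (hopf_alg G) p \<longrightarrow> (\<forall>a\<in>hopf_alg G. p a \<le> norm a))"


section \<open>Woronowicz characters, modular group and unitary antipode\<close>

definition woronowicz_characters ::
    "('a::unital_cstar_algebra, 'c::unital_cstar_algebra, 'd::unital_cstar_algebra) quantum_group
     \<Rightarrow> ('a \<Rightarrow> complex) \<Rightarrow> ('a \<Rightarrow> 'a) \<Rightarrow> ('a \<Rightarrow> complex) \<Rightarrow> (complex \<Rightarrow> 'a \<Rightarrow> complex) \<Rightarrow> bool" where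
  "woronowicz_characters G \<epsilon> S h f \<longleftrightarrow>
     (\<forall>z. clinear_on (hopf_alg G) (f z) \<and> f z 1 = 1 \<and>
        (\<forall>a\<in>hopf_alg G. \<forall>b\<in>hopf_alg G. f z (a * b) = f z a * f z b)) \<and>
     (\<forall>a\<in>hopf_alg G. (\<lambda>z. f z a) holomorphic_on UNIV) \<and>
     (\<forall>a\<in>hopf_alg G. f 0 a = \<epsilon> a) \<and>
     (\<forall>w z. \<forall>a\<in>hopf_alg G. conv G (f w) (f z) a = f (w + z) a) \<and>
     (\<forall>z. \<forall>a\<in>hopf_alg G. f z (S a) = f (- z) a) \<and>
     (\<forall>z. \<forall>a\<in>hopf_alg G. f (cnj z) (star a) = cnj (f (- z) a)) \<and>
     (\<forall>a\<in>hopf_alg G. S (S a) = rconv G (lconv G (f (- 1)) a) (f 1)) \<and>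
     (\<forall>a\<in>hopf_alg G. \<forall>b\<in>hopf_alg G. h (a * b) = h (b * rconv G (lconv G (f 1) a) (f 1)))"

definition modular ::
    "('a::unital_cstar_algebra, 'c::unital_cstar_algebra, 'd::unital_cstar_algebra) quantum_group
     \<Rightarrow> (complex \<Rightarrow> 'a \<Rightarrow> complex) \<Rightarrow> complex \<Rightarrow> 'a \<Rightarrow> 'a" where
  "modular G f z a = rconv G (lconv G (f (\<i> * z)) a) (f (\<i> * z))"

definition unitary_antipode ::
    "('a::unital_cstar_algebra, 'c::unital_cstar_algebra, 'd::unital_cstar_algebra) quantum_group
     \<Rightarrow> ('a \<Rightarrow> 'a) \<Rightarrow> (complex \<Rightarrow> 'a \<Rightarrow> complex) \<Rightarrow> 'a \<Rightarrow> 'a" where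
  "unitary_antipode G S f a = S (rconv G (lconv G (f (1/2)) a) (f (- 1/2)))"

text \<open>In the next definition \<open>B\<close> is a \<open>\<sigma>\<close>-invariant *-subalgebra of \<open>A\<close> consisting of entire analytic elements, and \<open>\<tau> z\<close>
  is \<open>\<sigma>\<^sub>z\<close> on \<open>B\<close>. For real \<open>s\<close> the automorphism \<open>\<sigma>\<^sub>s\<close> of \<open>hopf_alg G\<close> extends to \<open>A\<close> by continuity;
  the graph of the extension is the closure of the graph of \<open>\<sigma>\<^sub>s\<close>. For complex \<open>z\<close>, \<open>\<sigma>\<^sub>z\<close> is obtained
  by analytic continuation. The algebra \<open>hopf_alg G\<close> with \<open>\<tau> = modular G f\<close> is an example.\<close>

definition modular_subalgebra ::
    "('a::unital_cstar_algebra, 'c::unital_cstar_algebra, 'd::unital_cstar_algebra) quantum_group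
     \<Rightarrow> (complex \<Rightarrow> 'a \<Rightarrow> complex) \<Rightarrow> 'a set \<Rightarrow> (complex \<Rightarrow> 'a \<Rightarrow> 'a) \<Rightarrow> bool" where
  "modular_subalgebra G f B \<tau> \<longleftrightarrow> star_subalgebra B \<and>
     (\<forall>b\<in>B. (\<forall>z. \<tau> z b \<in> B) \<and> entire_curve (\<lambda>z. \<tau> z b) \<and>
        (\<forall>s::real. (b, \<tau> (complex_of_real s) b)
           \<in> closure {(x, modular G f (complex_of_real s) x) | x. x \<in> hopf_alg G}))"

definition KMS_symmetric ::
    "('a::unital_cstar_algebra, 'c::unital_cstar_algebra, 'd::unital_cstar_algebra) quantum_group
     \<Rightarrow> (complex \<Rightarrow> 'a \<Rightarrow> complex) \<Rightarrow> ('a \<Rightarrow> complex) \<Rightarrow> ('a \<Rightarrow> 'a) \<Rightarrow> bool" where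
  "KMS_symmetric G f h P \<longleftrightarrow>
     (\<exists>B \<tau>. modular_subalgebra G f B \<tau> \<and> closure B = UNIV \<and>
        (\<forall>a\<in>B. \<forall>b\<in>B. h (a * P b) = h (\<tau> (\<i> / 2) b * P (\<tau> (- \<i> / 2) a))))"


section \<open>Generating functionals and Markov semigroups\<close>

definition generating_functional ::
    "('a::unital_cstar_algebra, 'c::unital_cstar_algebra, 'd::unital_cstar_algebra) quantum_group
     \<Rightarrow> ('a \<Rightarrow> complex) \<Rightarrow> ('a \<Rightarrow> complex) \<Rightarrow> bool" where
  "generating_functional G \<epsilon> \<phi> \<longleftrightarrow> clinear_on (hopf_alg G) \<phi> \<and>
     (\<forall>a\<in>hopf_alg G. \<phi> (star a) = cnj (\<phi> a)) \<and> \<phi> 1 = 0 \<and>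
     (\<forall>a\<in>hopf_alg G. \<epsilon> a = 0 \<longrightarrow> \<phi> (star a * a) \<in> \<real>\<^sub>\<ge>\<^sub>0)"

primrec conv_power ::
    "('a::unital_cstar_algebra, 'c::unital_cstar_algebra, 'd::unital_cstar_algebra) quantum_group
     \<Rightarrow> ('a \<Rightarrow> complex) \<Rightarrow> ('a \<Rightarrow> complex) \<Rightarrow> nat \<Rightarrow> 'a \<Rightarrow> complex" where
  "conv_power G \<epsilon> \<phi> 0 = \<epsilon>"
| "conv_power G \<epsilon> \<phi> (Suc k) = conv G \<phi> (conv_power G \<epsilon> \<phi> k)"

definition conv_exp ::
    "('a::unital_cstar_algebra, 'c::unital_cstar_algebra, 'd::unital_cstar_algebra) quantum_group
     \<Rightarrow> ('a \<Rightarrow> complex) \<Rightarrow> ('a \<Rightarrow> complex) \<Rightarrow> real \<Rightarrow> 'a \<Rightarrow> complex" where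
  "conv_exp G \<epsilon> \<phi> t a = (\<Sum>k. complex_of_real (t ^ k / fact k) * conv_power G \<epsilon> \<phi> k a)"

definition markov_semigroup ::
    "('a::unital_cstar_algebra, 'c::unital_cstar_algebra, 'd::unital_cstar_algebra) quantum_group
     \<Rightarrow> ('a \<Rightarrow> complex) \<Rightarrow> ('a \<Rightarrow> complex) \<Rightarrow> (real \<Rightarrow> 'a \<Rightarrow> 'a) \<Rightarrow> bool" where
  "markov_semigroup G \<epsilon> \<phi> T \<longleftrightarrow>
     (\<forall>t\<ge>0. completely_positive (T t) \<and> T t 1 = 1 \<and> (\<forall>a. norm (T t a) \<le> norm a)) \<and>
     T 0 = id \<and> (\<forall>s\<ge>0. \<forall>t\<ge>0. T (s + t) = T s \<circ> T t) \<and>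
     (\<forall>a. continuous_on {0..} (\<lambda>t. T t a)) \<and>
     (\<forall>t\<ge>0. \<forall>a\<in>hopf_alg G. T t a = lconv G (conv_exp G \<epsilon> \<phi> t) a)"

end

theory Submission
  imports Defs "HOL-Complex_Analysis.Conformal_Mappings"
begin

text \<open>
  On a matrix \<open>u\<close> of coefficients of a unitary corepresentation, a functional \<open>\<mu>\<close> becomes the scalar
  matrix \<open>\<mu>(u)\<close>, and \<open>\<mu> \<star> u = u \<mu>(u)\<close>, \<open>u \<star> \<mu> = \<mu>(u) u\<close>, \<open>S(u) = u\<^sup>*\<close>. Invariance of \<open>h\<close> gives
  the strong invariance \<open>h(L\<^sub>\<psi>(a) b) = h(a L\<^bsub>\<psi>\<circ>S\<^esub>(b))\<close>, and unitarity of \<open>u\<close> shows that \<open>\<psi>\<close> vanishes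
  as soon as all \<open>h(a L\<^sub>\<psi>(b))\<close> do. Hence \<open>L\<^sub>\<psi>\<close> satisfies detailed balance iff \<open>\<psi> \<circ> S = \<psi>\<close>. For the
  KMS version, moving \<open>\<sigma>\<^bsub>i/2\<^esub>\<close> across \<open>h\<close> turns the symmetry of \<open>L\<^sub>\<psi>\<close> into
  \<open>f\<^bsub>1/2\<^esub> \<star> \<psi> = (\<psi> \<circ> S) \<star> f\<^bsub>1/2\<^esub>\<close>, which says \<open>\<psi> \<circ> R = \<psi>\<close>. Both \<open>S\<close> and \<open>R\<close> reverse convolution, so
  invariance of \<open>\<phi>\<close> passes to its convolution powers and to \<open>exp\<^sub>\<star>(t\<phi>)\<close>; conversely \<open>\<phi>\<close> is the
  derivative of \<open>exp\<^sub>\<star>(t\<phi>)\<close> at \<open>t = 0\<close>.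

  In (a3) the symmetry of \<open>T\<^sub>t\<close> is given on some dense modular subalgebra \<open>B\<close>, unrelated to the Hopf
  algebra. It is transferred by approximating \<open>a\<close> and \<open>b\<close> by elements of \<open>B\<close>: for an entire orbit \<open>F\<close> of
  the modular group, \<open>h(F(z) \<sigma>\<^sub>z(y)) = h(F(0) y)\<close> by the identity theorem, and with the KMS property and
  the Cauchy-Schwarz inequality this bounds \<open>h(F(i/2) x)\<close> by a multiple of the norms of \<open>F(0)\<close> and \<open>x\<close>,
  although \<open>\<sigma>\<^bsub>i/2\<^esub>\<close> itself is unbounded.
\<close>

section \<open>Complex linear maps, tensor products and entire functions\<close>

interpretation cvs: vector_space "scaleC :: complex \<Rightarrow> 'a::unital_cstar_algebra \<Rightarrow> 'a"
proof
  show "1 *\<^sub>C x = x" for x :: 'a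
    using scaleC_of_real[of 1 x] by simp
qed (simp_all add: scaleC_add_right scaleC_add_left scaleC_scaleC)

lemma clinear_onI:
  "(\<And>x y. x \<in> V \<Longrightarrow> y \<in> V \<Longrightarrow> f (x + y) = f x + f y) \<Longrightarrow>
   (\<And>c x. x \<in> V \<Longrightarrow> f (c *\<^sub>C x) = c *\<^sub>C f x) \<Longrightarrow> clinear_on V f"
  by (simp add: clinear_on_def)

lemma clinear_on_add: "clinear_on V f \<Longrightarrow> x \<in> V \<Longrightarrow> y \<in> V \<Longrightarrow> f (x + y) = f x + f y"
  and clinear_on_scale: "clinear_on V f \<Longrightarrow> x \<in> V \<Longrightarrow> f (c *\<^sub>C x) = c *\<^sub>C f x"
  by (simp_all add: clinear_on_def)

lemma clinear_on_zero: "clinear_on V f \<Longrightarrow> cvs.subspace V \<Longrightarrow> f 0 = 0"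
  using clinear_on_scale[of V f 0 0] by (simp add: cvs.subspace_0)

lemma clinear_on_diff:
  assumes "clinear_on V f" "cvs.subspace V" "x \<in> V" "y \<in> V"
  shows "f (x - y) = f x - f y"
  using clinear_on_add[OF assms(1,3), of "(-1) *\<^sub>C y"] clinear_on_scale[OF assms(1,4), of "-1"]
    cvs.subspace_scale[OF assms(2,4), of "-1"] by simp

lemma clinear_on_sum:
  assumes "clinear_on V f" "cvs.subspace V" "\<And>i. i \<in> I \<Longrightarrow> x i \<in> V"
  shows "f (\<Sum>i\<in>I. x i) = (\<Sum>i\<in>I. f (x i))"
  using assms(3)
proof (induction I rule: infinite_finite_induct)
  case (insert a F)
  then have "(\<Sum>i\<in>F. x i) \<in> V"
    by (intro cvs.subspace_sum assms(2)) auto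
  with insert show ?case
    by (simp add: clinear_on_add[OF assms(1)])
qed (simp_all add: clinear_on_zero[OF assms(1,2)])

lemma star_zero [simp]: "star (0 :: 'a::unital_cstar_algebra) = 0"
  using star_add[of 0 "0::'a"] by simp

lemma star_one [simp]: "star (1 :: 'a::unital_cstar_algebra) = 1"
  using star_mult[of 1 "star (1::'a)"] by (simp add: star_star)

lemma star_sum: "star (\<Sum>i\<in>I. x i) = (\<Sum>i\<in>I. star (x i))" for x :: "'i \<Rightarrow> 'a::unital_cstar_algebra"
  by (induction I rule: infinite_finite_induct) (simp_all add: star_add)

section \<open>Linear relations between elementary tensors\<close>

definition cbilinear_on ::
  "'a::unital_cstar_algebra set \<Rightarrow> ('a \<Rightarrow> 'a \<Rightarrow> 'b::unital_cstar_algebra) \<Rightarrow> bool" where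
  "cbilinear_on V B \<longleftrightarrow> (\<forall>x\<in>V. clinear_on V (B x)) \<and> (\<forall>y\<in>V. clinear_on V (\<lambda>x. B x y))"

text \<open>Injectivity of the algebraic tensor product is available for independent left factors,
  so the \<open>x i\<close> are expanded in a maximal independent subset \<open>X\<close> and the
  sum is regrouped along \<open>X\<close>. All regrouped right factors then vanish, and any bilinear
  map sees the same cancellation.\<close>

lemma min_tensor_product_sum_eq_0:
  fixes t :: "'a::unital_cstar_algebra \<Rightarrow> 'a \<Rightarrow> 'c::unital_cstar_algebra"
    and B :: "'a \<Rightarrow> 'a \<Rightarrow> 'b::unital_cstar_algebra"
  assumes t: "min_tensor_product t" and V: "cvs.subspace V" and B: "cbilinear_on V B"
    and I: "finite I" and x: "\<And>i. i \<in> I \<Longrightarrow> x i \<in> V" and y: "\<And>i. i \<in> I \<Longrightarrow> y i \<in> V"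
    and 0: "(\<Sum>i\<in>I. t (x i) (y i)) = 0"
  shows "(\<Sum>i\<in>I. B (x i) (y i)) = 0"
proof -
  obtain X where X: "X \<subseteq> x ` I" "cvs.independent X" "x ` I \<subseteq> cvs.span X"
    using cvs.maximal_independent_subset[of "x ` I"] by blast
  have fX: "finite X" and XV: "X \<subseteq> V"
    using X(1) I x by (auto intro: finite_subset)
  have "\<forall>i\<in>I. \<exists>c. x i = (\<Sum>b\<in>X. c b *\<^sub>C b)"
    using X(3) by (force simp: cvs.span_finite[OF fX])
  then obtain c where c: "\<And>i. i \<in> I \<Longrightarrow> x i = (\<Sum>b\<in>X. c i b *\<^sub>C b)"
    by metis
  define w where "w b = (\<Sum>i\<in>I. c i b *\<^sub>C y i)" for b
  \<comment> \<open>Stated for an arbitrary \<open>W\<close> because it serves twice: for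
    \<open>t\<close> on the whole algebra and for \<open>B\<close> on \<open>V\<close>.\<close>
  have regroup: "(\<Sum>i\<in>I. D (x i) (y i)) = (\<Sum>b\<in>X. D b (w b))" if D: "cbilinear_on W D"
    and W: "cvs.subspace W" "V \<subseteq> W"
    for W and D :: "'a \<Rightarrow> 'a \<Rightarrow> 'e::unital_cstar_algebra"
  proof -
    have D1: "clinear_on W (D u)" and D2: "clinear_on W (\<lambda>u. D u v)" if "u \<in> W" "v \<in> W" for u v
      using D that by (auto simp: cbilinear_on_def)
    have D3: "D (k *\<^sub>C u) v = k *\<^sub>C D u v" if "u \<in> W" "v \<in> W" for k u v
      using clinear_on_scale[OF D2[OF that] that(1)] .
    have D4: "D u (k *\<^sub>C v) = k *\<^sub>C D u v" if "u \<in> W" "v \<in> W" for k u v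
      using clinear_on_scale[OF D1[OF that] that(2)] .
    have inW: "b \<in> X \<Longrightarrow> b \<in> W" "i \<in> I \<Longrightarrow> y i \<in> W" for b i
      using XV y W(2) by auto
    have "(\<Sum>i\<in>I. D (x i) (y i)) = (\<Sum>i\<in>I. \<Sum>b\<in>X. c i b *\<^sub>C D b (y i))"
    proof (rule sum.cong[OF refl])
      fix i assume i: "i \<in> I"
      show "D (x i) (y i) = (\<Sum>b\<in>X. c i b *\<^sub>C D b (y i))"
        unfolding c[OF i]
        by (subst clinear_on_sum[OF D2[of "y i"] W(1)])
          (auto simp: i inW cvs.subspace_scale[OF W(1)] D3 intro!: sum.cong)
    qed
    also have "\<dots> = (\<Sum>b\<in>X. \<Sum>i\<in>I. c i b *\<^sub>C D b (y i))"
      by (rule sum.swap)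
    also have "\<dots> = (\<Sum>b\<in>X. D b (w b))"
    proof (rule sum.cong[OF refl])
      fix b assume b: "b \<in> X"
      show "(\<Sum>i\<in>I. c i b *\<^sub>C D b (y i)) = D b (w b)"
        unfolding w_def
        by (subst clinear_on_sum[OF D1[of b b] W(1)])
          (auto simp: b inW cvs.subspace_scale[OF W(1)] D4 intro!: sum.cong)
    qed
    finally show ?thesis .
  qed
  have "(\<Sum>b\<in>X. t b (w b)) = 0"
    using t 0 by (subst regroup[of UNIV t, symmetric])
      (auto simp: min_tensor_product_def cbilinear_on_def)
  then have "\<forall>b\<in>X. w b = 0"
    using t fX X(2) unfolding min_tensor_product_def by blast
  moreover have "B b 0 = 0" if "b \<in> X" for b
    using B XV that by (intro clinear_on_zero[OF _ V]) (auto simp: cbilinear_on_def)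
  ultimately show ?thesis
    by (subst regroup[OF B V]) auto
qed

lemma clinear_on_compose:
  "clinear_on V f \<Longrightarrow> (\<And>x. x \<in> V \<Longrightarrow> f x \<in> W) \<Longrightarrow> clinear_on W g \<Longrightarrow> clinear_on V (\<lambda>x. g (f x))"
  by (simp add: clinear_on_def)

lemma clinear_on_ident: "clinear_on V (\<lambda>x. x)"
  by (simp add: clinear_on_def)

lemma clinear_on_mult_left: "clinear_on V f \<Longrightarrow> clinear_on V (\<lambda>x. c * f x)"
  by (simp add: clinear_on_def distrib_left scaleC_mult_right)

lemma clinear_on_mult_right: "clinear_on V f \<Longrightarrow> clinear_on V (\<lambda>x. f x * c)"
  by (simp add: clinear_on_def distrib_right scaleC_mult_left)

lemma clinear_on_scaleC_left:
  "clinear_on V f \<Longrightarrow> clinear_on V (\<lambda>x. f x *\<^sub>C c)" for f :: "_ \<Rightarrow> complex"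
  by (simp add: clinear_on_def scaleC_add_left scaleC_complex_def scaleC_scaleC)

lemma clinear_on_scaleC_right:
  "clinear_on V f \<Longrightarrow> clinear_on V (\<lambda>x. k *\<^sub>C f x)"
  by (simp add: clinear_on_def scaleC_add_right scaleC_scaleC mult.commute)

lemma clinear_on_diff_fun:
  "clinear_on V f \<Longrightarrow> clinear_on V g \<Longrightarrow> clinear_on V (\<lambda>x. f x - g x)"
  by (simp add: clinear_on_def cvs.scale_right_diff_distrib)

lemma clinear_on_sum_fun:
  "(\<And>i. i \<in> I \<Longrightarrow> clinear_on V (f i)) \<Longrightarrow> clinear_on V (\<lambda>x. \<Sum>i\<in>I. f i x)"
  by (simp add: clinear_on_def sum.distrib cvs.scale_sum_right)

lemma clinear_on_subset: "clinear_on W f \<Longrightarrow> V \<subseteq> W \<Longrightarrow> clinear_on V f"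
  unfolding clinear_on_def by blast

lemmas clinear_on_intros = clinear_on_ident clinear_on_mult_left clinear_on_mult_right
  clinear_on_scaleC_left clinear_on_scaleC_right clinear_on_diff_fun clinear_on_sum_fun

section \<open>Unitary corepresentations\<close>

lemma subspace_hopf_alg: "cvs.subspace (hopf_alg G)"
  by (simp add: hopf_alg_def)

lemma unitary_corep_one:
  assumes "compact_quantum_group G"
  shows "unitary_corep G 1 (\<lambda>i j. 1)"
  using assms
  by (simp add: unitary_corep_def compact_quantum_group_def unital_star_hom_def
      min_tensor_product_def)

lemma clinear_on_lincomb:
  assumes "clinear_on V f" "cvs.subspace V" "\<And>i. i \<in> I \<Longrightarrow> x i \<in> V"
  shows "f (\<Sum>i\<in>I. c i *\<^sub>C x i) = (\<Sum>i\<in>I. c i *\<^sub>C f (x i))"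
  using assms
  by (subst clinear_on_sum[OF assms(1,2)]) (auto simp: cvs.subspace_scale clinear_on_scale[OF assms(1)])

text \<open>This is the tensor product of two corepresentations, with the index pair
  \<open>(p, q)\<close> encoded as \<open>p * m + q\<close>. It closes the Hopf algebra under
  multiplication.\<close>

lemma unitary_corep_tensor:
  assumes G: "compact_quantum_group G" and u: "unitary_corep G n u" and v: "unitary_corep G m v"
  shows "unitary_corep G (n * m) (\<lambda>i j. u (i div m) (j div m) * v (i mod m) (j mod m))"
proof -
  have lt: "i div m < n" "i mod m < m" if "i < n * m" for i
  proof -
    have "0 < m" using that by (cases m) auto
    with that show "i div m < n" "i mod m < m"
      by (simp_all add: less_mult_imp_div_less)
  qed
  have sum_split: "(\<Sum>k<n * m. g (k div m) (k mod m)) = (\<Sum>p<n. \<Sum>q<m. g p q)"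
    for g :: "nat \<Rightarrow> nat \<Rightarrow> 'e::comm_monoid_add"
    unfolding sum_mult_product by (intro sum.cong refl) simp
  have eq_iff: "(i div m = j div m \<and> i mod m = j mod m) \<longleftrightarrow> i = j" for i j
    by (metis div_mult_mod_eq)
  have [simp]: "comult G (a * b) = comult G a * comult G b" for a b
    using G by (simp add: compact_quantum_group_def unital_star_hom_def)
  have tm: "tens G a b * tens G a' b' = tens G (a * a') (b * b')" for a b a' b'
    using G by (simp add: compact_quantum_group_def min_tensor_product_def)
  show ?thesis
    unfolding unitary_corep_def
  proof (intro allI impI conjI)
    fix i j assume i: "i < n * m" and j: "j < n * m"
    note u' = u[unfolded unitary_corep_def, rule_format, OF lt(1)[OF i] lt(1)[OF j]]
    note v' = v[unfolded unitary_corep_def, rule_format, OF lt(2)[OF i] lt(2)[OF j]]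
    \<comment> \<open>\<open>star\<close> reverses products, so the sum over \<open>p\<close> sits
      inside and collapses by unitarity of \<open>u\<close> before that of \<open>v\<close>. In the
      second relation the two roles are exchanged.\<close>
    have "(\<Sum>k<n * m. star (u (k div m) (i div m) * v (k mod m) (i mod m)) *
            (u (k div m) (j div m) * v (k mod m) (j mod m))) =
          (\<Sum>q<m. star (v q (i mod m)) * (\<Sum>p<n. star (u p (i div m)) * u p (j div m)) * v q (j mod m))"
      by (subst sum_split[of "\<lambda>p q. star (u p (i div m) * v q (i mod m)) *
            (u p (j div m) * v q (j mod m))"], subst sum.swap)
        (simp add: star_mult sum_distrib_left sum_distrib_right mult.assoc)
    also have "\<dots> = (if i = j then 1 else 0)"
      using u' v' eq_iff[of i j] by (cases "i div m = j div m") auto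
    finally show "(\<Sum>k<n * m. star (u (k div m) (i div m) * v (k mod m) (i mod m)) *
            (u (k div m) (j div m) * v (k mod m) (j mod m))) = (if i = j then 1 else 0)" .
    have "(\<Sum>k<n * m. u (i div m) (k div m) * v (i mod m) (k mod m) *
            star (u (j div m) (k div m) * v (j mod m) (k mod m))) =
          (\<Sum>p<n. u (i div m) p * (\<Sum>q<m. v (i mod m) q * star (v (j mod m) q)) * star (u (j div m) p))"
      by (subst sum_split[of "\<lambda>p q. u (i div m) p * v (i mod m) q *
            star (u (j div m) p * v (j mod m) q)"])
        (simp add: star_mult sum_distrib_left sum_distrib_right mult.assoc)
    also have "\<dots> = (if i = j then 1 else 0)"
      using u' v' eq_iff[of i j] by (cases "i mod m = j mod m") auto
    finally show "(\<Sum>k<n * m. u (i div m) (k div m) * v (i mod m) (k mod m) *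
            star (u (j div m) (k div m) * v (j mod m) (k mod m))) = (if i = j then 1 else 0)" .
    show "comult G (u (i div m) (j div m) * v (i mod m) (j mod m)) =
      (\<Sum>k<n * m. tens G (u (i div m) (k div m) * v (i mod m) (k mod m))
         (u (k div m) (j div m) * v (k mod m) (j mod m)))"
      using u' v' by (subst sum_split[of "\<lambda>p q. tens G (u (i div m) p * v (i mod m) q)
         (u p (j div m) * v q (j mod m))"]) (simp add: sum_product tm)
  qed
qed

text \<open>The linear coefficient is the derivative at 0. This recovers a generating functional
  from its convolution exponential.\<close>

lemma power_series_eq_0_right_imp_coeff_1_eq_0:
  fixes c :: "nat \<Rightarrow> complex"
  assumes sm: "\<And>y. summable (\<lambda>n. c n * y ^ n)"
    and 0: "\<And>t::real. 0 \<le> t \<Longrightarrow> (\<Sum>n. c n * of_real t ^ n) = 0"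
  shows "c 1 = 0"
proof -
  let ?F = "\<lambda>x. \<Sum>n. c n * x ^ n"
  have "(?F has_field_derivative (\<Sum>n. diffs c n * 0 ^ n)) (at 0)"
    by (rule termdiffs_strong_converges_everywhere[OF sm])
  then have D: "((\<lambda>y. (?F y - ?F 0) / (y - 0)) \<longlongrightarrow> c 1) (at 0)"
    unfolding has_field_derivative_iff by (simp add: diffs_def powser_zero)
  \<comment> \<open>Vanishing is known on the nonnegative reals, so 0 is approached through the
    positive sequence \<open>1 / (n + 1)\<close>.\<close>
  have "filterlim (\<lambda>n. complex_of_real (inverse (real (Suc n)))) (at 0) sequentially"
    unfolding filterlim_at
  proof (intro conjI)
    show "(\<lambda>n. complex_of_real (inverse (real (Suc n)))) \<longlonglongrightarrow> 0"
      using tendsto_of_real[OF LIMSEQ_inverse_real_of_nat, where 'a = complex] by (simp only: of_real_0)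
  qed (simp only: of_real_eq_0_iff inverse_nonzero_iff_nonzero, simp)
  from filterlim_compose[OF D this]
  have "(\<lambda>n. (?F (complex_of_real (inverse (real (Suc n)))) - ?F 0) /
      (complex_of_real (inverse (real (Suc n))) - 0)) \<longlonglongrightarrow> c 1" .
  moreover have "?F (complex_of_real (inverse (real (Suc n)))) = 0" for n
    by (rule 0) simp
  moreover have "?F 0 = 0"
    using 0[of 0] by simp
  ultimately have "(\<lambda>n. 0) \<longlonglongrightarrow> c 1"
    by simp
  then show ?thesis
    by (simp add: LIMSEQ_const_iff)
qed

section \<open>Entire curves in the algebra\<close>

lemma clinear_imp_linear: "clinear_on UNIV F \<Longrightarrow> linear F"
  by (rule linearI) (simp_all add: clinear_on_def scaleC_of_real[symmetric])

lemma bounded_linear_scaleC_left: "bounded_linear (\<lambda>c. c *\<^sub>C (y :: 'a::unital_cstar_algebra))"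
proof (rule bounded_linear_intro)
  show "(r *\<^sub>R c) *\<^sub>C y = r *\<^sub>R (c *\<^sub>C y)" for r c
    using scaleC_scaleC[of "of_real r" c y] by (simp only: scaleC_of_real scaleR_conv_of_real[of r c])
qed (auto simp: scaleC_add_left norm_scaleC)

lemma entire_curve_add:
  assumes "entire_curve F" "entire_curve H"
  shows "entire_curve (\<lambda>z. F z + H z)"
  unfolding entire_curve_def add_diff_add scaleC_add_right
proof
  fix z
  obtain D D' where "((\<lambda>w. inverse (w - z) *\<^sub>C (F w - F z)) \<longlongrightarrow> D) (at z)"
    "((\<lambda>w. inverse (w - z) *\<^sub>C (H w - H z)) \<longlongrightarrow> D') (at z)"
    using assms unfolding entire_curve_def by blast
  from tendsto_add[OF this]
  show "\<exists>D. ((\<lambda>w. inverse (w - z) *\<^sub>C (F w - F z) + inverse (w - z) *\<^sub>C (H w - H z))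
      \<longlongrightarrow> D) (at z)" ..
qed

lemma entire_curve_scale:
  fixes F :: "complex \<Rightarrow> 'a::unital_cstar_algebra"
  assumes "entire_curve F"
  shows "entire_curve (\<lambda>z. c *\<^sub>C F z)"
  unfolding entire_curve_def
proof
  fix z
  obtain D where D: "((\<lambda>w. inverse (w - z) *\<^sub>C (F w - F z)) \<longlongrightarrow> D) (at z)"
    using assms unfolding entire_curve_def by blast
  have "bounded_linear (\<lambda>y::'a. c *\<^sub>C y)"
    by (rule bounded_linear_intro[of _ "cmod c"])
      (simp_all add: scaleC_add_right norm_scaleC scaleC_of_real[symmetric] scaleC_scaleC mult.commute)
  from bounded_linear.tendsto[OF this D]
  show "\<exists>D. ((\<lambda>w. inverse (w - z) *\<^sub>C (c *\<^sub>C F w - c *\<^sub>C F z)) \<longlongrightarrow> D) (at z)"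
    unfolding cvs.scale_right_diff_distrib[symmetric] scaleC_scaleC mult.commute[of c] by blast
qed

lemma entire_curve_diff:
  assumes "entire_curve F" "entire_curve H"
  shows "entire_curve (\<lambda>z. F z - H z)"
  using entire_curve_add[OF assms(1) entire_curve_scale[OF assms(2), of "-1"]] by simp

lemma entire_curve_holomorphic_scaleC:
  assumes "c holomorphic_on UNIV"
  shows "entire_curve (\<lambda>z. c z *\<^sub>C y)"
  unfolding entire_curve_def
proof
  fix z
  obtain D where "(c has_field_derivative D) (at z)"
    using assms by (auto simp: holomorphic_on_def field_differentiable_def)
  then have "((\<lambda>w. (c w - c z) / (w - z)) \<longlongrightarrow> D) (at z)"
    by (simp add: has_field_derivative_iff)
  from bounded_linear.tendsto[OF bounded_linear_scaleC_left this, of y]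
  show "\<exists>D. ((\<lambda>w. inverse (w - z) *\<^sub>C (c w *\<^sub>C y - c z *\<^sub>C y)) \<longlongrightarrow> D) (at z)"
    by (auto simp: cvs.scale_left_diff_distrib[symmetric] scaleC_scaleC divide_inverse mult.commute)
qed

lemma entire_curve_compose_holomorphic:
  fixes g :: "'a::unital_cstar_algebra \<Rightarrow> complex"
  assumes F: "entire_curve F" and g: "bounded_linear g" "clinear_on UNIV g"
  shows "(\<lambda>z. g (F z)) holomorphic_on UNIV"
proof -
  have "(\<lambda>z. g (F z)) field_differentiable (at z)" for z
  proof -
    obtain D where "((\<lambda>w. inverse (w - z) *\<^sub>C (F w - F z)) \<longlongrightarrow> D) (at z)"
      using F by (auto simp: entire_curve_def)
    from bounded_linear.tendsto[OF g(1) this]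
    have "((\<lambda>w. (g (F w) - g (F z)) / (w - z)) \<longlongrightarrow> g D) (at z)"
      by (simp add: clinear_on_scale[OF g(2)] linear_diff[OF bounded_linear.linear[OF g(1)]]
          scaleC_complex_def divide_inverse mult.commute)
    then show ?thesis
      unfolding field_differentiable_def has_field_derivative_iff by blast
  qed
  then show ?thesis
    by (simp add: holomorphic_on_def)
qed

text \<open>Identity theorem: the real axis accumulates at 0 and the plane is connected.\<close>

lemma entire_eq_if_eq_on_reals:
  assumes "H holomorphic_on UNIV" "K holomorphic_on UNIV" "\<And>s::real. H (of_real s) = K (of_real s)"
  shows "H z = K z"
proof -
  have hol: "(\<lambda>z. H z - K z) holomorphic_on UNIV"
    using assms by (intro holomorphic_intros)
  have lim: "(0::complex) islimpt range of_real"
    unfolding islimpt_approachable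
  proof (intro allI impI)
    fix e :: real assume "0 < e"
    then show "\<exists>x\<in>range complex_of_real. x \<noteq> 0 \<and> dist x 0 < e"
      by (intro bexI[of _ "of_real (e / 2)"] rangeI) auto
  qed
  have "H z - K z = 0"
    by (rule analytic_continuation[OF hol open_UNIV connected_UNIV subset_UNIV UNIV_I lim])
      (use assms(3) in auto)
  then show ?thesis by simp
qed

section \<open>Functionals and convolution on the Hopf *-algebra\<close>

text \<open>The reduced and the universal case are treated together: both provide
  \<open>dense\<close>.\<close>

locale woronowicz_cqg =
  fixes G :: "('a::unital_cstar_algebra, 'c::unital_cstar_algebra, 'd::unital_cstar_algebra)
                quantum_group"
    and \<epsilon> :: "'a \<Rightarrow> complex" and S :: "'a \<Rightarrow> 'a" and h :: "'a \<Rightarrow> complex"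
    and f :: "complex \<Rightarrow> 'a \<Rightarrow> complex"
  assumes cqg: "compact_quantum_group G"
    and counit: "is_counit G \<epsilon>" and antipode: "is_antipode G \<epsilon> S" and haar: "haar_state G h"
    and dense: "closure (hopf_alg G) = UNIV"
    and woronowicz: "woronowicz_characters G \<epsilon> S h f"
begin

abbreviation "A \<equiv> hopf_alg G"
abbreviation "alg_tensor \<equiv> cspan {tens G x y | x y. x \<in> A \<and> y \<in> A}"

lemmas A_sub = subspace_hopf_alg[of G]
lemmas A_add = cvs.subspace_add[OF A_sub]
lemmas A_scale = cvs.subspace_scale[OF A_sub]
lemmas A_sum = cvs.subspace_sum[OF A_sub]
lemmas A_diff = cvs.subspace_diff[OF A_sub]

lemma coef_in_A: "unitary_corep G n u \<Longrightarrow> i < n \<Longrightarrow> j < n \<Longrightarrow> u i j \<in> A"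
  unfolding hopf_alg_def by (rule cvs.span_base) auto

lemma one_in_A: "1 \<in> A"
  using coef_in_A[OF unitary_corep_one[OF cqg], of 0 0] by simp

text \<open>Span induction over coefficients. There is no case for 0, which is obtained as 0 times
  the coefficient 1 of the trivial corepresentation.\<close>

lemma A_induct [consumes 1, case_names coef add scale]:
  assumes a: "a \<in> A"
    and coef: "\<And>n u i j. unitary_corep G n u \<Longrightarrow> i < n \<Longrightarrow> j < n \<Longrightarrow> P (u i j)"
    and add: "\<And>x y. x \<in> A \<Longrightarrow> y \<in> A \<Longrightarrow> P x \<Longrightarrow> P y \<Longrightarrow> P (x + y)"
    and scale: "\<And>c x. x \<in> A \<Longrightarrow> P x \<Longrightarrow> P (c *\<^sub>C x)"
  shows "P a"
proof -
  have "P 1"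
    using coef[OF unitary_corep_one[OF cqg], of 0 0] by simp
  from scale[OF one_in_A this, of 0] have "P 0"
    by simp
  then have sub: "cvs.subspace {x. x \<in> A \<and> P x}"
    using add scale A_sub by (auto simp: cvs.subspace_def)
  have "a \<in> A \<and> P a"
    by (rule cvs.span_induct[OF a[unfolded hopf_alg_def] sub]) (auto intro: coef coef_in_A)
  then show ?thesis by simp
qed

text \<open>The main device for identities: after reduction to coefficients they become matrix
  identities within a single corepresentation.\<close>

lemma A_eqI:
  assumes "a \<in> A" "clinear_on A F" "clinear_on A H"
    and "\<And>n u i j. unitary_corep G n u \<Longrightarrow> i < n \<Longrightarrow> j < n \<Longrightarrow> F (u i j) = H (u i j)"
  shows "F a = H a"
  using assms(1)
proof (induction a rule: A_induct)
qed (simp_all add: assms(4) clinear_on_add[OF assms(2)] clinear_on_add[OF assms(3)]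
      clinear_on_scale[OF assms(2)] clinear_on_scale[OF assms(3)])

lemma A_memI:
  assumes "a \<in> A" "clinear_on A F"
    and "\<And>n u i j. unitary_corep G n u \<Longrightarrow> i < n \<Longrightarrow> j < n \<Longrightarrow> F (u i j) \<in> A"
  shows "F a \<in> A"
  using assms(1)
proof (induction a rule: A_induct)
qed (simp_all add: assms(3) clinear_on_add[OF assms(2)] A_add A_scale clinear_on_scale[OF assms(2)])

section \<open>Lifts of bilinear maps to the algebraic tensor square\<close>

lemma tens: "min_tensor_product (tens G)"
  using cqg by (simp add: compact_quantum_group_def)

lemma tens_clinear: "clinear_on UNIV (\<lambda>a. tens G a b)" "clinear_on UNIV (tens G a)"
  using tens by (simp_all add: min_tensor_product_def)

lemma tens_mult: "tens G a b * tens G a' b' = tens G (a * a') (b * b')"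
  and tens_star: "star (tens G a b) = tens G (star a) (star b)"
  using tens by (simp_all add: min_tensor_product_def)

lemma tens_scale: "tens G (c *\<^sub>C a) b = c *\<^sub>C tens G a b"
  using clinear_on_scale[OF tens_clinear(1)] by simp

lemma comult_clinear: "clinear_on UNIV (comult G)"
  and comult_mult: "comult G (a * b) = comult G a * comult G b"
  and comult_star: "comult G (star a) = star (comult G a)"
  using cqg by (simp_all add: compact_quantum_group_def unital_star_hom_def)

lemma corepD:
  assumes "unitary_corep G n u" "i < n" "j < n"
  shows "(\<Sum>k<n. star (u k i) * u k j) = (if i = j then 1 else 0)"
    and "(\<Sum>k<n. u i k * star (u j k)) = (if i = j then 1 else 0)"
    and "comult G (u i j) = (\<Sum>k<n. tens G (u i k) (u k j))"
  using assms unfolding unitary_corep_def by blast+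

text \<open>The definite description in \<open>tlift_def\<close> is meaningful because two
  representations of one tensor differ by a vanishing sum of elementary tensors, which every
  bilinear map sends to 0.\<close>

lemma tlift_sum:
  fixes B :: "'a \<Rightarrow> 'a \<Rightarrow> 'b::unital_cstar_algebra"
  assumes B: "cbilinear_on A B" and I: "finite I"
    and xy: "\<And>i. i \<in> I \<Longrightarrow> x i \<in> A" "\<And>i. i \<in> I \<Longrightarrow> y i \<in> A"
  shows "tlift G B (\<Sum>i\<in>I. tens G (x i) (y i)) = (\<Sum>i\<in>I. B (x i) (y i))"
  unfolding tlift_def
proof (rule the_equality)
  obtain g where g: "bij_betw g {0..<card I} I"
    using ex_bij_betw_nat_finite[OF I] by blast
  show "\<exists>(n::nat) x' y'. (\<forall>i<n. x' i \<in> A \<and> y' i \<in> A) \<and>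
      (\<Sum>i\<in>I. tens G (x i) (y i)) = (\<Sum>i<n. tens G (x' i) (y' i)) \<and>
      (\<Sum>i\<in>I. B (x i) (y i)) = (\<Sum>i<n. B (x' i) (y' i))"
  proof (rule exI[of _ "card I"], rule exI[of _ "\<lambda>i. x (g i)"], rule exI[of _ "\<lambda>i. y (g i)"],
      intro conjI allI impI)
    show "(\<Sum>i\<in>I. tens G (x i) (y i)) = (\<Sum>i<card I. tens G (x (g i)) (y (g i)))"
      "(\<Sum>i\<in>I. B (x i) (y i)) = (\<Sum>i<card I. B (x (g i)) (y (g i)))"
      using sum.reindex_bij_betw[OF g, of "\<lambda>i. tens G (x i) (y i)"]
        sum.reindex_bij_betw[OF g, of "\<lambda>i. B (x i) (y i)"]
      by (simp_all add: atLeast0LessThan)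
  qed (use bij_betwE[OF g] xy in auto)
next
  fix v
  assume "\<exists>(n::nat) x' y'. (\<forall>i<n. x' i \<in> A \<and> y' i \<in> A) \<and>
      (\<Sum>i\<in>I. tens G (x i) (y i)) = (\<Sum>i<n. tens G (x' i) (y' i)) \<and>
      v = (\<Sum>i<n. B (x' i) (y' i))"
  then obtain n :: nat and x' y' where n: "\<And>i. i < n \<Longrightarrow> x' i \<in> A" "\<And>i. i < n \<Longrightarrow> y' i \<in> A"
    and eq: "(\<Sum>i\<in>I. tens G (x i) (y i)) = (\<Sum>i<n. tens G (x' i) (y' i))"
    and v: "v = (\<Sum>i<n. B (x' i) (y' i))"
    by blast
  \<comment> \<open>The first representation is joined with the negative of the second over a
    disjoint union; the sign is placed in the left factors.\<close>
  define X where "X = case_sum x (\<lambda>i. (-1) *\<^sub>C x' i)"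
  define Y where "Y = case_sum y y'"
  have XY: "X p \<in> A" "Y p \<in> A" if "p \<in> I <+> {..<n}" for p
    using that xy n by (auto simp: X_def Y_def A_scale cvs.subspace_neg[OF A_sub])
  have "B ((-1) *\<^sub>C x' i) (y' i) = (-1) *\<^sub>C B (x' i) (y' i)" if "i < n" for i
    using B n[OF that] clinear_on_scale[where f = "\<lambda>u. B u (y' i)"]
    unfolding cbilinear_on_def by blast
  moreover have minus: "(-1) *\<^sub>C w = - w" for w :: 'c
    by simp
  have "(\<Sum>p\<in>I <+> {..<n}. tens G (X p) (Y p)) = 0"
    using I eq minus by (simp add: sum.Plus X_def Y_def tens_scale sum_negf del: cvs.scale_minus_left)
  then have "(\<Sum>p\<in>I <+> {..<n}. B (X p) (Y p)) = 0"
    using XY I by (intro min_tensor_product_sum_eq_0[OF tens A_sub B]) auto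
  ultimately show "v = (\<Sum>i\<in>I. B (x i) (y i))"
    using I v by (simp add: sum.Plus X_def Y_def sum_negf)
qed

text \<open>The scalars of the span are absorbed into the left factors.\<close>

lemma alg_tensorE:
  assumes "z \<in> alg_tensor"
  obtains n :: nat and x y where "\<And>i. i < n \<Longrightarrow> x i \<in> A" "\<And>i. i < n \<Longrightarrow> y i \<in> A"
    "z = (\<Sum>i<n. tens G (x i) (y i))"
proof -
  have "\<exists>(n::nat) x y. (\<forall>i<n. x i \<in> A \<and> y i \<in> A) \<and> z = (\<Sum>i<n. tens G (x i) (y i))"
    using assms
  proof (induction z rule: cvs.span_induct_alt)
    case base
    show ?case by (rule exI[of _ 0]) simp
  next
    case (step c w z)
    then obtain a b x y and n :: nat where *: "w = tens G a b" "a \<in> A" "b \<in> A" "\<forall>i<n. x i \<in> A \<and> y i \<in> A"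
      "z = (\<Sum>i<n. tens G (x i) (y i))" by blast
    then show ?case
      by - (rule exI[of _ "Suc n"], rule exI[of _ "case_nat (c *\<^sub>C a) x"],
          rule exI[of _ "case_nat b y"],
          auto simp: sum.lessThan_Suc_shift tens_scale A_scale less_Suc_eq_0_disj
            simp del: sum.lessThan_Suc)
  qed
  with that show thesis by blast
qed

lemma tlift_clinear:
  fixes B :: "'a \<Rightarrow> 'a \<Rightarrow> 'b::unital_cstar_algebra"
  assumes B: "cbilinear_on A B"
  shows "clinear_on alg_tensor (tlift G B)"
proof (rule clinear_onI)
  fix z w assume z: "z \<in> alg_tensor" and w: "w \<in> alg_tensor"
  obtain n :: nat and x y where
    z: "\<And>i. i < n \<Longrightarrow> x i \<in> A" "\<And>i. i < n \<Longrightarrow> y i \<in> A" "z = (\<Sum>i<n. tens G (x i) (y i))"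
    using alg_tensorE[OF z] by blast
  obtain m :: nat and x' y' where
    w: "\<And>i. i < m \<Longrightarrow> x' i \<in> A" "\<And>i. i < m \<Longrightarrow> y' i \<in> A" "w = (\<Sum>i<m. tens G (x' i) (y' i))"
    using alg_tensorE[OF w] by blast
  note * = z(1,2) w(1,2)
  \<comment> \<open>The representations of \<open>z\<close> and \<open>w\<close> are concatenated,
    so that one application of \<open>tlift_sum\<close> covers \<open>z + w\<close>.\<close>
  let ?I = "{..<n} <+> {..<m}"
  have "tlift G B (\<Sum>p\<in>?I. tens G (case_sum x x' p) (case_sum y y' p)) =
      (\<Sum>p\<in>?I. B (case_sum x x' p) (case_sum y y' p))"
    by (rule tlift_sum[OF B]) (auto simp: *)
  moreover have "tlift G B z = (\<Sum>i<n. B (x i) (y i))" "tlift G B w = (\<Sum>i<m. B (x' i) (y' i))"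
    unfolding z(3) w(3) by (rule tlift_sum[OF B]; simp add: *)+
  ultimately show "tlift G B (z + w) = tlift G B z + tlift G B w"
    using z(3) w(3) by (simp add: sum.Plus)
next
  fix c z assume z: "z \<in> alg_tensor"
  obtain n :: nat and x y
    where *: "\<And>i. i < n \<Longrightarrow> x i \<in> A" "\<And>i. i < n \<Longrightarrow> y i \<in> A" "z = (\<Sum>i<n. tens G (x i) (y i))"
    using alg_tensorE[OF z] by blast
  have "tlift G B (\<Sum>i<n. tens G (c *\<^sub>C x i) (y i)) = (\<Sum>i<n. B (c *\<^sub>C x i) (y i))"
    by (rule tlift_sum[OF B]) (auto simp: * A_scale)
  moreover have "B (c *\<^sub>C x i) (y i) = c *\<^sub>C B (x i) (y i)" if "i < n" for i
    using B *(1,2)[OF that] clinear_on_scale[where f = "\<lambda>u. B u (y i)"]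
    unfolding cbilinear_on_def by blast
  ultimately show "tlift G B (c *\<^sub>C z) = c *\<^sub>C tlift G B z"
    unfolding *(3) using tlift_sum[OF B, of "{..<n}" x y] *(1,2)
    by (simp add: tens_scale cvs.scale_sum_right)
qed

lemma comult_in_alg_tensor: "a \<in> A \<Longrightarrow> comult G a \<in> alg_tensor"
proof (induction a rule: A_induct)
  case (coef n u i j)
  then show ?case
    unfolding corepD(3)[OF coef]
    by (intro cvs.span_sum cvs.span_base) (auto intro: coef_in_A)
qed (simp_all add: clinear_on_add[OF comult_clinear] clinear_on_scale[OF comult_clinear]
      cvs.span_add cvs.span_scale)

lemma tlift_comult_clinear: "cbilinear_on A B \<Longrightarrow> clinear_on A (\<lambda>a. tlift G B (comult G a))"
  for B :: "'a \<Rightarrow> 'a \<Rightarrow> 'b::unital_cstar_algebra"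
  by (rule clinear_on_compose[OF clinear_on_subset[OF comult_clinear] _ tlift_clinear])
    (auto intro: comult_in_alg_tensor)

lemma tlift_comult_coef:
  fixes B :: "'a \<Rightarrow> 'a \<Rightarrow> 'b::unital_cstar_algebra"
  assumes "cbilinear_on A B" "unitary_corep G n u" "i < n" "j < n"
  shows "tlift G B (comult G (u i j)) = (\<Sum>k<n. B (u i k) (u k j))"
  unfolding corepD(3)[OF assms(2-)]
  by (rule tlift_sum[OF assms(1)]) (auto intro: coef_in_A assms)

section \<open>Linear functionals and their convolution actions\<close>

abbreviation "lin \<mu> \<equiv> clinear_on A (\<mu> :: 'a \<Rightarrow> complex)"

lemma cbilinear_conv: "lin \<mu> \<Longrightarrow> lin \<nu> \<Longrightarrow> cbilinear_on A (\<lambda>x y. \<mu> x * \<nu> y)"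
  and cbilinear_lconv: "lin \<mu> \<Longrightarrow> cbilinear_on A (\<lambda>x y. \<mu> y *\<^sub>C x)"
  and cbilinear_rconv: "lin \<mu> \<Longrightarrow> cbilinear_on A (\<lambda>x y. \<mu> x *\<^sub>C y)"
  unfolding cbilinear_on_def by (auto intro!: clinear_on_intros)

lemma conv_clinear: "lin \<mu> \<Longrightarrow> lin \<nu> \<Longrightarrow> lin (conv G \<mu> \<nu>)"
  and lconv_clinear: "lin \<mu> \<Longrightarrow> clinear_on A (lconv G \<mu>)"
  and rconv_clinear: "lin \<mu> \<Longrightarrow> clinear_on A (\<lambda>a. rconv G a \<mu>)"
  unfolding conv_def lconv_def rconv_def
  by (intro tlift_comult_clinear cbilinear_conv cbilinear_lconv cbilinear_rconv; assumption)+

lemma conv_coef: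
  "lin \<mu> \<Longrightarrow> lin \<nu> \<Longrightarrow> unitary_corep G n u \<Longrightarrow> i < n \<Longrightarrow> j < n \<Longrightarrow>
    conv G \<mu> \<nu> (u i j) = (\<Sum>k<n. \<mu> (u i k) * \<nu> (u k j))"
  and lconv_coef:
  "lin \<mu> \<Longrightarrow> unitary_corep G n u \<Longrightarrow> i < n \<Longrightarrow> j < n \<Longrightarrow>
    lconv G \<mu> (u i j) = (\<Sum>k<n. \<mu> (u k j) *\<^sub>C u i k)"
  and rconv_coef:
  "lin \<mu> \<Longrightarrow> unitary_corep G n u \<Longrightarrow> i < n \<Longrightarrow> j < n \<Longrightarrow>
    rconv G (u i j) \<mu> = (\<Sum>k<n. \<mu> (u i k) *\<^sub>C u k j)"
  unfolding conv_def lconv_def rconv_def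
  by (intro tlift_comult_coef cbilinear_conv cbilinear_lconv cbilinear_rconv; assumption)+

lemma lconv_in_A: "lin \<mu> \<Longrightarrow> a \<in> A \<Longrightarrow> lconv G \<mu> a \<in> A"
  by (erule A_memI[OF _ lconv_clinear]) (auto simp: lconv_coef intro!: A_sum A_scale coef_in_A)

lemma rconv_in_A: "lin \<mu> \<Longrightarrow> a \<in> A \<Longrightarrow> rconv G a \<mu> \<in> A"
  by (erule A_memI[OF _ rconv_clinear]) (auto simp: rconv_coef intro!: A_sum A_scale coef_in_A)

lemma lconv_clinear_compose:
  assumes "lin \<mu>" "clinear_on A F" "\<And>a. a \<in> A \<Longrightarrow> F a \<in> A"
  shows "clinear_on A (\<lambda>a. lconv G \<mu> (F a))"
  by (rule clinear_on_compose[OF assms(2,3) lconv_clinear[OF assms(1)]])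

lemma rconv_clinear_compose:
  assumes "lin \<mu>" "clinear_on A F" "\<And>a. a \<in> A \<Longrightarrow> F a \<in> A"
  shows "clinear_on A (\<lambda>a. rconv G (F a) \<mu>)"
  by (rule clinear_on_compose[OF assms(2,3) rconv_clinear[OF assms(1)]])

lemma lincomb_coef:
  assumes F: "clinear_on A F" and u: "unitary_corep G n u"
  shows "i < n \<Longrightarrow> F (\<Sum>k<n. c k *\<^sub>C u i k) = (\<Sum>k<n. c k *\<^sub>C F (u i k))"
    and "j < n \<Longrightarrow> F (\<Sum>k<n. c k *\<^sub>C u k j) = (\<Sum>k<n. c k *\<^sub>C F (u k j))"
  by (rule clinear_on_lincomb[OF F A_sub]; simp add: coef_in_A[OF u])+

section \<open>Counit, antipode and Haar state on coefficients\<close>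

lemma \<epsilon>_lin: "lin \<epsilon>"
  and lconv_counit: "a \<in> A \<Longrightarrow> lconv G \<epsilon> a = a"
  and rconv_counit: "a \<in> A \<Longrightarrow> rconv G a \<epsilon> = a"
  using counit by (simp_all add: is_counit_def)

lemma S_clinear: "clinear_on A S"
  and S_in_A: "a \<in> A \<Longrightarrow> S a \<in> A"
  using antipode by (auto simp: is_antipode_def)

lemma h_clinear: "clinear_on UNIV h" and h_bounded: "bounded_linear h" and h_one: "h 1 = 1"
  and h_pos: "h (star x * x) \<in> \<real>\<^sub>\<ge>\<^sub>0"
  using haar by (simp_all add: haar_state_def state_def)

lemma h_add: "h (x + y) = h x + h y"
  and h_scale: "h (c *\<^sub>C x) = c * h x"
  using clinear_on_add[OF h_clinear, of x y] clinear_on_scale[OF h_clinear, of x c]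
  by (auto simp: scaleC_complex_def)

lemma h_diff: "h (x - y) = h x - h y"
  and h_zero: "h 0 = 0"
  using h_bounded by (simp_all add: linear_diff bounded_linear.linear linear_0)

lemma h_sum: "h (\<Sum>i\<in>I. x i) = (\<Sum>i\<in>I. h (x i))"
  using h_bounded by (simp add: bounded_linear.linear linear_sum)

lemma h_lin: "lin h"
  using clinear_on_subset[OF h_clinear] by simp

text \<open>Multiplying \<open>u c\<close> from the left by the adjoint matrix of \<open>u\<close>
  returns the scalar vector \<open>c\<close>, so scalars can be read off from combinations of the
  entries of \<open>u\<close>.\<close>

lemma corep_extract:
  assumes u: "unitary_corep G n u" and i: "i < n"
  shows "(\<Sum>k<n. star (u k i) * (\<Sum>m<n. c m *\<^sub>C u k m)) = c i *\<^sub>C 1"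
proof -
  have "(\<Sum>k<n. star (u k i) * (\<Sum>m<n. c m *\<^sub>C u k m)) =
      (\<Sum>m<n. c m *\<^sub>C (\<Sum>k<n. star (u k i) * u k m))"
    by (simp add: sum_distrib_left scaleC_mult_right cvs.scale_sum_right) (rule sum.swap)
  also have "\<dots> = (\<Sum>m<n. if m = i then c m *\<^sub>C 1 else 0)"
    using corepD(1)[OF u i] by (intro sum.cong) auto
  finally show ?thesis
    using i by simp
qed

lemma scaleC_one_eq_iff: "c *\<^sub>C (1::'a) = d *\<^sub>C 1 \<longleftrightarrow> c = d"
  by simp

text \<open>The counit law says that \<open>u\<close> times the scalar matrix of \<epsilon> is
  \<open>u\<close>; cancelling \<open>u\<close> by unitarity leaves the identity matrix.\<close>

lemma \<epsilon>_coef: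
  assumes u: "unitary_corep G n u" and ij: "i < n" "j < n"
  shows "\<epsilon> (u i j) = (if i = j then 1 else 0)"
proof -
  have "(\<Sum>m<n. \<epsilon> (u m j) *\<^sub>C u k m) = u k j" if "k < n" for k
    using lconv_coef[OF \<epsilon>_lin u that ij(2)] lconv_counit[OF coef_in_A[OF u that ij(2)]] by simp
  then have "\<epsilon> (u i j) *\<^sub>C (1::'a) = (\<Sum>k<n. star (u k i) * u k j)"
    using corep_extract[OF u ij(1), of "\<lambda>m. \<epsilon> (u m j)"] by simp
  also have "\<dots> = (if i = j then 1 else 0) *\<^sub>C 1"
    using corepD(1)[OF u ij] by simp
  finally show ?thesis
    unfolding scaleC_one_eq_iff .
qed

text \<open>The antipode law makes the matrix \<open>S (u i k)\<close> a left inverse of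
  \<open>u\<close>. Multiplying by the adjoint of \<open>u\<close> on the right identifies it with
  that adjoint.\<close>

lemma S_coef:
  assumes u: "unitary_corep G n u" and il: "i < n" "l < n"
  shows "S (u i l) = star (u l i)"
proof -
  have B: "cbilinear_on A (\<lambda>x y. S x * y)"
    unfolding cbilinear_on_def by (auto intro!: clinear_on_intros S_clinear)
  have *: "(\<Sum>k<n. S (u i k) * u k j) = \<epsilon> (u i j) *\<^sub>C 1" if "j < n" for j
    using tlift_comult_coef[OF B u il(1) that] antipode coef_in_A[OF u il(1) that]
    by (simp add: is_antipode_def)
  have "star (u l i) = (\<Sum>j<n. (\<epsilon> (u i j) *\<^sub>C 1) * star (u l j))"
    using il by (simp add: \<epsilon>_coef[OF u] scaleC_mult_left if_distrib[of "\<lambda>c. c *\<^sub>C _"]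
        if_distrib[of "\<lambda>c. c * _"] cong: if_cong)
  also have "\<dots> = (\<Sum>j<n. (\<Sum>k<n. S (u i k) * u k j) * star (u l j))"
    using * by simp
  also have "\<dots> = (\<Sum>k<n. S (u i k) * (\<Sum>j<n. u k j * star (u l j)))"
    unfolding sum_distrib_left sum_distrib_right by (subst sum.swap) (simp add: mult.assoc)
  also have "\<dots> = (\<Sum>k<n. if k = l then S (u i k) else 0)"
    using corepD(2)[OF u _ il(2)] by (intro sum.cong) auto
  finally show ?thesis
    using il by simp
qed

text \<open>By \<open>S_coef\<close> the star of a coefficient is the antipode of the transposed
  coefficient, and \<open>S\<close> preserves \<open>A\<close>.\<close>

lemma star_in_A: "a \<in> A \<Longrightarrow> star a \<in> A"
proof (induction a rule: A_induct)
  case (coef n u i j)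
  then show ?case
    using S_coef[OF coef(1,3,2)] S_in_A[OF coef_in_A[OF coef(1,3,2)]] by simp
qed (simp_all add: star_add star_scaleC A_add A_scale)

lemma mult_in_A: "a \<in> A \<Longrightarrow> b \<in> A \<Longrightarrow> a * b \<in> A"
proof (induction a rule: A_induct)
  case (coef n u i j)
  from \<open>b \<in> A\<close> show ?case
  proof (induction b rule: A_induct)
    case v: (coef m v k l)
    \<comment> \<open>\<open>i * m + k\<close> is the position of the pair \<open>(i, k)\<close> in
      the tensor product corepresentation.\<close>
    have "i * m + k < n * m" if "i < n" "k < m" for i k
    proof -
      have "i * m + k < Suc i * m" using that by simp
      also have "\<dots> \<le> n * m" using that by (intro mult_right_mono) auto
      finally show ?thesis .
    qed
    from this[OF coef(2) v(2)] this[OF coef(3) v(3)]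
    have "i * m + k < n * m" "j * m + l < n * m" .
    from coef_in_A[OF unitary_corep_tensor[OF cqg coef(1) v(1)] this] show ?case
      using v by simp
  qed (simp_all add: distrib_left scaleC_mult_right A_add A_scale)
qed (simp_all add: distrib_right scaleC_mult_left A_add A_scale)

text \<open>The starred entries are not presented as coefficients of a unitary corepresentation, so
  their comultiplication is computed from that of \<open>u\<close> by applying
  \<open>star\<close>.\<close>

lemma tlift_comult_star_coef:
  fixes B :: "'a \<Rightarrow> 'a \<Rightarrow> 'b::unital_cstar_algebra"
  assumes B: "cbilinear_on A B" and u: "unitary_corep G n u" and ij: "i < n" "j < n"
  shows "tlift G B (comult G (star (u i j))) = (\<Sum>k<n. B (star (u i k)) (star (u k j)))"
  unfolding comult_star corepD(3)[OF u ij] star_sum tens_star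
  by (rule tlift_sum[OF B]) (auto intro: coef_in_A[OF u] star_in_A ij)

lemma tlift_comult_mult_coef:
  fixes B :: "'a \<Rightarrow> 'a \<Rightarrow> 'b::unital_cstar_algebra"
  assumes B: "cbilinear_on A B" and u: "unitary_corep G n u" and ij: "i < n" "j < n"
    and v: "unitary_corep G m v" and kl: "k < m" "l < m"
  shows "tlift G B (comult G (u i j * v k l)) =
    (\<Sum>p<n. \<Sum>q<m. B (u i p * v k q) (u p j * v q l))"
  unfolding comult_mult corepD(3)[OF u ij] corepD(3)[OF v kl] sum_product tens_mult
    sum.cartesian_product case_prod_unfold
  by (rule tlift_sum[OF B]) (auto intro!: coef_in_A[OF u] coef_in_A[OF v] mult_in_A ij kl)

section \<open>Algebra of convolutions\<close>

lemma S_lin: "lin \<mu> \<Longrightarrow> lin (\<lambda>a. \<mu> (S a))"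
  by (rule clinear_on_compose[OF S_clinear S_in_A])

lemma conv_lconv:
  assumes "lin \<mu>" "lin \<nu>" "a \<in> A"
  shows "\<mu> (lconv G \<nu> a) = conv G \<mu> \<nu> a"
proof (rule A_eqI[where F = "\<lambda>a. \<mu> (lconv G \<nu> a)", OF assms(3)])
  fix n u i j assume u: "unitary_corep G n u" "i < n" "j < n"
  show "\<mu> (lconv G \<nu> (u i j)) = conv G \<mu> \<nu> (u i j)"
    using u by (simp add: assms lconv_coef conv_coef lincomb_coef[OF assms(1) u(1)]
        scaleC_complex_def mult.commute)
qed (intro clinear_on_compose[OF lconv_clinear lconv_in_A] conv_clinear assms; assumption)+

lemma conv_rconv:
  assumes "lin \<mu>" "lin \<nu>" "a \<in> A"
  shows "\<nu> (rconv G a \<mu>) = conv G \<mu> \<nu> a"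
proof (rule A_eqI[where F = "\<lambda>a. \<nu> (rconv G a \<mu>)", OF assms(3)])
  fix n u i j assume u: "unitary_corep G n u" "i < n" "j < n"
  show "\<nu> (rconv G (u i j) \<mu>) = conv G \<mu> \<nu> (u i j)"
    using u by (simp add: assms rconv_coef conv_coef lincomb_coef[OF assms(2) u(1)]
        scaleC_complex_def)
qed (intro clinear_on_compose[OF rconv_clinear rconv_in_A] conv_clinear assms; assumption)+

lemma lconv_lconv:
  assumes "lin \<mu>" "lin \<nu>" "a \<in> A"
  shows "lconv G \<mu> (lconv G \<nu> a) = lconv G (conv G \<mu> \<nu>) a"
proof (rule A_eqI[OF assms(3)])
  fix n u i j assume u: "unitary_corep G n u" "i < n" "j < n"
  from u have "lconv G \<mu> (lconv G \<nu> (u i j)) =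
      (\<Sum>k<n. \<Sum>m<n. (\<nu> (u k j) * \<mu> (u m k)) *\<^sub>C u i m)"
    using assms by (simp add: lconv_coef lincomb_coef[OF lconv_clinear u(1)]
        cvs.scale_sum_right scaleC_scaleC)
  also have "\<dots> = (\<Sum>m<n. (\<Sum>k<n. \<mu> (u m k) * \<nu> (u k j)) *\<^sub>C u i m)"
    by (subst sum.swap) (simp add: cvs.scale_sum_left mult.commute)
  finally show "lconv G \<mu> (lconv G \<nu> (u i j)) = lconv G (conv G \<mu> \<nu>) (u i j)"
    using u assms by (simp add: lconv_coef conv_clinear conv_coef)
qed (intro lconv_clinear lconv_clinear_compose lconv_in_A conv_clinear assms; assumption)+

lemma rconv_rconv:
  assumes "lin \<mu>" "lin \<nu>" "a \<in> A"
  shows "rconv G (rconv G a \<mu>) \<nu> = rconv G a (conv G \<mu> \<nu>)"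
proof (rule A_eqI[OF assms(3)])
  fix n u i j assume u: "unitary_corep G n u" "i < n" "j < n"
  from u have "rconv G (rconv G (u i j) \<mu>) \<nu> =
      (\<Sum>k<n. \<Sum>m<n. (\<mu> (u i k) * \<nu> (u k m)) *\<^sub>C u m j)"
    using assms by (simp add: rconv_coef lincomb_coef[OF rconv_clinear u(1)]
        cvs.scale_sum_right scaleC_scaleC)
  also have "\<dots> = (\<Sum>m<n. (\<Sum>k<n. \<mu> (u i k) * \<nu> (u k m)) *\<^sub>C u m j)"
    by (subst sum.swap) (simp add: cvs.scale_sum_left)
  finally show "rconv G (rconv G (u i j) \<mu>) \<nu> = rconv G (u i j) (conv G \<mu> \<nu>)"
    using u assms by (simp add: rconv_coef conv_clinear conv_coef)
qed (intro rconv_clinear rconv_clinear_compose rconv_in_A conv_clinear assms; assumption)+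

text \<open>One action multiplies \<open>u\<close> by a scalar matrix on the right, the other on the
  left.\<close>

lemma lconv_rconv:
  assumes "lin \<mu>" "lin \<nu>" "a \<in> A"
  shows "lconv G \<mu> (rconv G a \<nu>) = rconv G (lconv G \<mu> a) \<nu>"
proof (rule A_eqI[OF assms(3)])
  fix n u i j assume u: "unitary_corep G n u" "i < n" "j < n"
  from u have "lconv G \<mu> (rconv G (u i j) \<nu>) =
      (\<Sum>k<n. \<Sum>m<n. (\<nu> (u i k) * \<mu> (u m j)) *\<^sub>C u k m)"
    using assms by (simp add: rconv_coef lconv_coef lincomb_coef[OF lconv_clinear u(1)] cvs.scale_sum_right scaleC_scaleC)
  also have "\<dots> = rconv G (lconv G \<mu> (u i j)) \<nu>"
    using assms u by (subst sum.swap) (simp add: rconv_coef lconv_coef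
        lincomb_coef[OF rconv_clinear u(1)] cvs.scale_sum_right scaleC_scaleC
        mult.commute)
  finally show "lconv G \<mu> (rconv G (u i j) \<nu>) = rconv G (lconv G \<mu> (u i j)) \<nu>" .
qed (intro rconv_clinear rconv_clinear_compose rconv_in_A lconv_in_A lconv_clinear
      lconv_clinear_compose assms; assumption)+

text \<open>Both sides are \<mu> evaluated on an iterated left action, so \<open>lconv_lconv\<close>
  gives associativity.\<close>

lemma conv_assoc:
  assumes "lin \<mu>" "lin \<nu>" "lin \<rho>" "a \<in> A"
  shows "conv G (conv G \<mu> \<nu>) \<rho> a = conv G \<mu> (conv G \<nu> \<rho>) a"
  using assms by (simp add: conv_lconv[symmetric] conv_clinear lconv_lconv lconv_in_A)

lemma conv_counit_left: "lin \<mu> \<Longrightarrow> a \<in> A \<Longrightarrow> conv G \<epsilon> \<mu> a = \<mu> a"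
  using conv_rconv[OF \<epsilon>_lin, of \<mu> a] by (simp add: rconv_counit)

lemma conv_counit_right: "lin \<mu> \<Longrightarrow> a \<in> A \<Longrightarrow> conv G \<mu> \<epsilon> a = \<mu> a"
  using conv_lconv[OF _ \<epsilon>_lin, of \<mu> a] by (simp add: lconv_counit)

text \<open>Functionals are total functions whose values outside \<open>A\<close> are arbitrary, so
  agreement on \<open>A\<close> has to be carried through convolutions explicitly.\<close>

lemma conv_cong:
  assumes "lin \<mu>" "lin \<nu>" "lin \<mu>'" "lin \<nu>'" "\<And>a. a \<in> A \<Longrightarrow> \<mu> a = \<mu>' a" "\<And>a. a \<in> A \<Longrightarrow> \<nu> a = \<nu>' a"
    "a \<in> A"
  shows "conv G \<mu> \<nu> a = conv G \<mu>' \<nu>' a"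
proof (rule A_eqI[OF assms(7)])
  fix n u i j assume u: "unitary_corep G n u" "i < n" "j < n"
  note uA = coef_in_A[OF u(1)]
  from u show "conv G \<mu> \<nu> (u i j) = conv G \<mu>' \<nu>' (u i j)"
    by (simp add: conv_coef assms uA)
qed (intro conv_clinear assms)+

lemma lconv_cong:
  assumes "lin \<mu>" "lin \<mu>'" "\<And>a. a \<in> A \<Longrightarrow> \<mu> a = \<mu>' a" "a \<in> A"
  shows "lconv G \<mu> a = lconv G \<mu>' a"
proof (rule A_eqI[OF assms(4)])
  fix n u i j assume u: "unitary_corep G n u" "i < n" "j < n"
  note uA = coef_in_A[OF u(1)]
  from u show "lconv G \<mu> (u i j) = lconv G \<mu>' (u i j)"
    by (simp add: lconv_coef assms uA)
qed (intro lconv_clinear assms)+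

lemma rconv_cong:
  assumes "lin \<mu>" "lin \<mu>'" "\<And>a. a \<in> A \<Longrightarrow> \<mu> a = \<mu>' a" "a \<in> A"
  shows "rconv G a \<mu> = rconv G a \<mu>'"
proof (rule A_eqI[where F = "\<lambda>a. rconv G a \<mu>", OF assms(4)])
  fix n u i j assume u: "unitary_corep G n u" "i < n" "j < n"
  note uA = coef_in_A[OF u(1)]
  from u show "rconv G (u i j) \<mu> = rconv G (u i j) \<mu>'"
    by (simp add: rconv_coef assms uA)
qed (intro rconv_clinear assms)+

lemma lconv_diff:
  assumes "lin \<mu>" "lin \<nu>" "a \<in> A"
  shows "lconv G (\<lambda>x. \<mu> x - \<nu> x) a = lconv G \<mu> a - lconv G \<nu> a"
  by (rule A_eqI[OF assms(3)])
    (auto simp: lconv_coef assms coef_in_A clinear_on_diff_fun cvs.scale_left_diff_distrib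
      sum_subtractf intro!: lconv_clinear assms clinear_on_diff_fun)

text \<open>\<open>S\<close> turns \<open>u\<close> into its adjoint, and the transposition of
  indices reverses the order of the two factors.\<close>

lemma conv_S:
  assumes "lin \<mu>" "lin \<nu>" "a \<in> A"
  shows "conv G \<mu> \<nu> (S a) = conv G (\<lambda>x. \<nu> (S x)) (\<lambda>x. \<mu> (S x)) a"
proof (rule A_eqI[OF assms(3)])
  fix n u i j assume u: "unitary_corep G n u" "i < n" "j < n"
  have "conv G \<mu> \<nu> (S (u i j)) = (\<Sum>k<n. \<mu> (star (u j k)) * \<nu> (star (u k i)))"
    unfolding S_coef[OF u] conv_def
    by (rule tlift_comult_star_coef[OF cbilinear_conv[OF assms(1,2)] u(1,3,2)])
  also have "\<dots> = conv G (\<lambda>x. \<nu> (S x)) (\<lambda>x. \<mu> (S x)) (u i j)"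
    using u assms by (simp add: conv_coef S_lin S_coef mult.commute)
  finally show "conv G \<mu> \<nu> (S (u i j)) = conv G (\<lambda>x. \<nu> (S x)) (\<lambda>x. \<mu> (S x)) (u i j)" .
qed (intro conv_clinear S_lin assms)+

lemma lin_star: "lin \<mu> \<Longrightarrow> lin (\<lambda>x. cnj (\<mu> (star x)))"
  by (auto simp: clinear_on_def star_add star_scaleC star_in_A scaleC_complex_def)

text \<open>Both sides are conjugate-linear in \<open>a\<close>, so the reduction to coefficients
  uses \<open>A_induct\<close> directly instead of \<open>A_eqI\<close>.\<close>

lemma lconv_star:
  assumes "lin \<mu>" "a \<in> A"
  shows "star (lconv G \<mu> a) = lconv G (\<lambda>x. cnj (\<mu> (star x))) (star a)"
  using assms(2)
proof (induction a rule: A_induct)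
  case (coef n u i j)
  show ?case
    unfolding lconv_coef[OF assms(1) coef]
    unfolding lconv_def tlift_comult_star_coef[OF cbilinear_lconv[OF lin_star[OF assms(1)]] coef]
    by (simp add: star_sum star_scaleC star_star)
qed (simp_all add: star_add star_scaleC star_in_A clinear_on_add[OF lconv_clinear[OF assms(1)]]
      clinear_on_scale[OF lconv_clinear[OF assms(1)]]
      clinear_on_add[OF lconv_clinear[OF lin_star[OF assms(1)]]]
      clinear_on_scale[OF lconv_clinear[OF lin_star[OF assms(1)]]])

lemma rconv_star:
  assumes "lin \<mu>" "a \<in> A"
  shows "star (rconv G a \<mu>) = rconv G (star a) (\<lambda>x. cnj (\<mu> (star x)))"
  using assms(2)
proof (induction a rule: A_induct)
  case (coef n u i j)
  show ?case
    unfolding rconv_coef[OF assms(1) coef]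
    unfolding rconv_def tlift_comult_star_coef[OF cbilinear_rconv[OF lin_star[OF assms(1)]] coef]
    by (simp add: star_sum star_scaleC star_star)
qed (simp_all add: star_add star_scaleC star_in_A clinear_on_add[OF rconv_clinear[OF assms(1)]]
      clinear_on_scale[OF rconv_clinear[OF assms(1)]]
      clinear_on_add[OF rconv_clinear[OF lin_star[OF assms(1)]]]
      clinear_on_scale[OF rconv_clinear[OF lin_star[OF assms(1)]]])

section \<open>Actions of characters\<close>

definition character :: "('a \<Rightarrow> complex) \<Rightarrow> bool" where
  "character \<mu> \<longleftrightarrow> lin \<mu> \<and> \<mu> 1 = 1 \<and> (\<forall>a\<in>A. \<forall>b\<in>A. \<mu> (a * b) = \<mu> a * \<mu> b)"

text \<open>Slicing the multiplicative map \<Delta> with a multiplicative functional is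
  multiplicative. Both arguments are reduced to coefficients, one after the other.\<close>

lemma lconv_mult:
  assumes \<mu>: "character \<mu>" and ab: "a \<in> A" "b \<in> A"
  shows "lconv G \<mu> (a * b) = lconv G \<mu> a * lconv G \<mu> b"
proof (rule A_eqI[where F = "\<lambda>a. lconv G \<mu> (a * b)", OF ab(1)])
  fix n u i j assume u: "unitary_corep G n u" "i < n" "j < n"
  note uA = coef_in_A[OF u(1)]
  have lin: "lin \<mu>" using \<mu> by (simp add: character_def)
  show "lconv G \<mu> (u i j * b) = lconv G \<mu> (u i j) * lconv G \<mu> b"
  proof (rule A_eqI[where F = "\<lambda>b. lconv G \<mu> (u i j * b)", OF ab(2)])
    fix m v k l assume v: "unitary_corep G m v" "k < m" "l < m"
    note vA = coef_in_A[OF v(1)]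
    have "lconv G \<mu> (u i j * v k l) =
        (\<Sum>p<n. \<Sum>q<m. \<mu> (u p j * v q l) *\<^sub>C (u i p * v k q))"
      unfolding lconv_def by (rule tlift_comult_mult_coef[OF cbilinear_lconv[OF lin] u v])
    also have "\<dots> = (\<Sum>p<n. \<Sum>q<m. (\<mu> (u p j) *\<^sub>C u i p) * (\<mu> (v q l) *\<^sub>C v k q))"
      using \<mu> u v by (intro sum.cong refl)
        (simp add: character_def uA vA scaleC_mult_left scaleC_mult_right scaleC_scaleC mult.commute)
    also have "\<dots> = lconv G \<mu> (u i j) * lconv G \<mu> (v k l)"
      unfolding lconv_coef[OF lin u] lconv_coef[OF lin v] sum_product ..
    finally show "lconv G \<mu> (u i j * v k l) = lconv G \<mu> (u i j) * lconv G \<mu> (v k l)" .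
  qed (intro lconv_clinear_compose lin clinear_on_intros lconv_clinear mult_in_A uA u; assumption)+
qed (use \<mu> ab in \<open>auto simp: character_def intro!: lconv_clinear_compose clinear_on_intros
      lconv_clinear mult_in_A\<close>)

lemma rconv_mult:
  assumes \<mu>: "character \<mu>" and ab: "a \<in> A" "b \<in> A"
  shows "rconv G (a * b) \<mu> = rconv G a \<mu> * rconv G b \<mu>"
proof (rule A_eqI[where F = "\<lambda>a. rconv G (a * b) \<mu>", OF ab(1)])
  fix n u i j assume u: "unitary_corep G n u" "i < n" "j < n"
  note uA = coef_in_A[OF u(1)]
  have lin: "lin \<mu>" using \<mu> by (simp add: character_def)
  show "rconv G (u i j * b) \<mu> = rconv G (u i j) \<mu> * rconv G b \<mu>"
  proof (rule A_eqI[where F = "\<lambda>b. rconv G (u i j * b) \<mu>", OF ab(2)])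
    fix m v k l assume v: "unitary_corep G m v" "k < m" "l < m"
    note vA = coef_in_A[OF v(1)]
    have "rconv G (u i j * v k l) \<mu> =
        (\<Sum>p<n. \<Sum>q<m. \<mu> (u i p * v k q) *\<^sub>C (u p j * v q l))"
      unfolding rconv_def by (rule tlift_comult_mult_coef[OF cbilinear_rconv[OF lin] u v])
    also have "\<dots> = (\<Sum>p<n. \<Sum>q<m. (\<mu> (u i p) *\<^sub>C u p j) * (\<mu> (v k q) *\<^sub>C v q l))"
      using \<mu> u v by (intro sum.cong refl)
        (simp add: character_def uA vA scaleC_mult_left scaleC_mult_right scaleC_scaleC mult.commute)
    also have "\<dots> = rconv G (u i j) \<mu> * rconv G (v k l) \<mu>"
      unfolding rconv_coef[OF lin u] rconv_coef[OF lin v] sum_product ..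
    finally show "rconv G (u i j * v k l) \<mu> = rconv G (u i j) \<mu> * rconv G (v k l) \<mu>" .
  qed (intro rconv_clinear_compose lin clinear_on_intros rconv_clinear mult_in_A uA u; assumption)+
qed (use \<mu> ab in \<open>auto simp: character_def intro!: rconv_clinear_compose clinear_on_intros
      rconv_clinear mult_in_A\<close>)

section \<open>Invariance properties of the Haar state\<close>

lemma haar_coef:
  assumes u: "unitary_corep G n u" "i < n" "j < n"
  shows "(\<Sum>k<n. h (u i k) *\<^sub>C u k j) = h (u i j) *\<^sub>C 1"
    and "(\<Sum>k<n. h (u k j) *\<^sub>C u i k) = h (u i j) *\<^sub>C 1"
proof -
  obtain E1 E2 where E: "bounded_linear E1" "\<And>a b. E1 (tens G a b) = h a *\<^sub>C b"
      "\<And>a. E1 (comult G a) = h a *\<^sub>C 1" "bounded_linear E2" "\<And>a b. E2 (tens G a b) = h b *\<^sub>C a"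
      "\<And>a. E2 (comult G a) = h a *\<^sub>C 1"
    using haar unfolding haar_state_def by blast
  show "(\<Sum>k<n. h (u i k) *\<^sub>C u k j) = h (u i j) *\<^sub>C 1"
    using E(3)[of "u i j"] unfolding corepD(3)[OF u]
    by (simp add: linear_sum[OF bounded_linear.linear[OF E(1)]] E(2))
  show "(\<Sum>k<n. h (u k j) *\<^sub>C u i k) = h (u i j) *\<^sub>C 1"
    using E(6)[of "u i j"] unfolding corepD(3)[OF u]
    by (simp add: linear_sum[OF bounded_linear.linear[OF E(4)]] E(5))
qed

text \<open>The slices by \<open>h\<close> and \<mu> commute, and slicing with \<open>h\<close>
  first leaves a multiple of 1. Functionals with value 1 at the unit therefore act without changing
  \<open>h\<close>.\<close>

lemma haar_lconv:
  assumes "lin \<mu>" "a \<in> A"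
  shows "h (lconv G \<mu> a) = \<mu> 1 * h a"
proof (rule A_eqI[where F = "\<lambda>a. h (lconv G \<mu> a)", OF assms(2)])
  fix n u i j assume u: "unitary_corep G n u" "i < n" "j < n"
  have "h (lconv G \<mu> (u i j)) = \<mu> (\<Sum>k<n. h (u i k) *\<^sub>C u k j)"
    using u assms by (simp add: lconv_coef h_sum h_scale lincomb_coef[OF assms(1) u(1)] scaleC_complex_def mult.commute)
  then show "h (lconv G \<mu> (u i j)) = \<mu> 1 * h (u i j)"
    unfolding haar_coef(1)[OF u]
    by (simp add: clinear_on_scale[OF assms(1) one_in_A] scaleC_complex_def mult.commute)
qed (intro clinear_on_intros clinear_on_compose[OF lconv_clinear lconv_in_A h_lin] h_lin assms;
    assumption)+

lemma haar_rconv: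
  assumes "lin \<mu>" "a \<in> A"
  shows "h (rconv G a \<mu>) = \<mu> 1 * h a"
proof (rule A_eqI[where F = "\<lambda>a. h (rconv G a \<mu>)", OF assms(2)])
  fix n u i j assume u: "unitary_corep G n u" "i < n" "j < n"
  have "h (rconv G (u i j) \<mu>) = \<mu> (\<Sum>k<n. h (u k j) *\<^sub>C u i k)"
    using u assms by (simp add: rconv_coef h_sum h_scale lincomb_coef[OF assms(1) u(1)] scaleC_complex_def mult.commute)
  then show "h (rconv G (u i j) \<mu>) = \<mu> 1 * h (u i j)"
    unfolding haar_coef(2)[OF u]
    by (simp add: clinear_on_scale[OF assms(1) one_in_A] scaleC_complex_def mult.commute)
qed (intro clinear_on_intros clinear_on_compose[OF rconv_clinear rconv_in_A h_lin] h_lin assms;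
    assumption)+

text \<open>Taking \<open>star (u k i)\<close> and \<open>u k j\<close> for the two arguments and
  summing over \<open>k\<close>, unitarity leaves \<theta> of \<open>u i j\<close> times the unit
  under \<open>h\<close>.\<close>

lemma haar_separating:
  assumes "lin \<theta>" "\<And>a b. a \<in> A \<Longrightarrow> b \<in> A \<Longrightarrow> h (a * lconv G \<theta> b) = 0" "a \<in> A"
  shows "\<theta> a = 0"
  using assms(3)
proof (induction a rule: A_induct)
  case (coef n u i j)
  have "\<theta> (u i j) = h (\<Sum>k<n. star (u k i) * lconv G \<theta> (u k j))"
    using corep_extract[OF coef(1,2), of "\<lambda>m. \<theta> (u m j)"] coef
    by (simp add: lconv_coef[OF assms(1)] h_scale h_one)
  also have "\<dots> = 0"
    using coef by (simp add: h_sum assms(2) star_in_A coef_in_A)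
  finally show ?case .
qed (simp_all add: clinear_on_add[OF assms(1)] clinear_on_scale[OF assms(1)] scaleC_complex_def)

text \<open>Invariance of \<open>h\<close> on the product of two coefficients controls both second
  legs at once. Cancelling one leg by unitarity moves it to the other side as an antipode, and then
  \<phi> is applied.\<close>

lemma haar_strong_invariance:
  assumes \<phi>: "lin \<phi>" and ab: "a \<in> A" "b \<in> A"
  shows "h (lconv G \<phi> a * b) = h (a * lconv G (\<lambda>x. \<phi> (S x)) b)"
proof (rule A_eqI[where F = "\<lambda>a. h (lconv G \<phi> a * b)", OF ab(1)])
  fix m v p q assume v: "unitary_corep G m v" "p < m" "q < m"
  note vA = coef_in_A[OF v(1)]
  show "h (lconv G \<phi> (v p q) * b) = h (v p q * lconv G (\<lambda>x. \<phi> (S x)) b)"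
  proof (rule A_eqI[where F = "\<lambda>b. h (lconv G \<phi> (v p q) * b)", OF ab(2)])
    fix n u k i assume u: "unitary_corep G n u" "k < n" "i < n"
    note uA = coef_in_A[OF u(1)]
    obtain E where E: "bounded_linear E" "\<And>a b. E (tens G a b) = h a *\<^sub>C b"
        "\<And>a. E (comult G a) = h a *\<^sub>C 1"
      using haar unfolding haar_state_def by blast
    \<comment> \<open>The slice of \<open>h\<close> on the first leg, applied to the
      comultiplication of a product of coefficients.\<close>
    have inv: "(\<Sum>r<m. \<Sum>l<n. h (v p r * u k l) *\<^sub>C (v r q * u l j)) = h (v p q * u k j) *\<^sub>C 1"
      if "j < n" for j
      using E(3)[of "v p q * u k j"]
      by (simp add: comult_mult corepD(3)[OF v] corepD(3)[OF u(1,2) that] sum_product tens_mult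
          linear_sum[OF bounded_linear.linear[OF E(1)]] E(2))
    \<comment> \<open>The identity is inserted as \<open>u\<close> times its adjoint, so that the
      product \<open>v r q * u l j\<close> of \<open>inv\<close> appears.\<close>
    have "(\<Sum>r<m. h (v p r * u k i) *\<^sub>C v r q) =
        (\<Sum>r<m. \<Sum>l<n. h (v p r * u k l) *\<^sub>C (v r q * (\<Sum>j<n. u l j * star (u i j))))"
      using u by (simp add: corepD(2)[OF u(1) _ u(3)] if_distrib[of "\<lambda>x. _ * x"]
          if_distrib[of "\<lambda>x. _ *\<^sub>C x"] cong: if_cong)
    also have "\<dots> = (\<Sum>r<m. \<Sum>l<n. \<Sum>j<n. h (v p r * u k l) *\<^sub>C (v r q * u l j * star (u i j)))"
      by (simp add: sum_distrib_left cvs.scale_sum_right mult.assoc)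
    also have "\<dots> = (\<Sum>j<n. \<Sum>r<m. \<Sum>l<n. h (v p r * u k l) *\<^sub>C (v r q * u l j * star (u i j)))"
      by (subst (2) sum.swap, subst sum.swap) simp
    also have "\<dots> = (\<Sum>j<n. (h (v p q * u k j) *\<^sub>C 1) * star (u i j))"
      by (intro sum.cong refl, subst inv[symmetric])
        (simp_all add: sum_distrib_right scaleC_mult_left)
    finally have "(\<Sum>r<m. h (v p r * u k i) *\<^sub>C v r q) = (\<Sum>j<n. h (v p q * u k j) *\<^sub>C S (u j i))"
      using u by (simp add: scaleC_mult_left S_coef)
    \<comment> \<open>Applying \<phi> to the two sides produces the scalars of \<open>lconv\<close>
      for \<phi> and for its composition with \<open>S\<close>.\<close>
    moreover have "\<phi> (\<Sum>r<m. h (v p r * u k i) *\<^sub>C v r q) =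
        (\<Sum>r<m. h (v p r * u k i) *\<^sub>C \<phi> (v r q))"
      using v by (intro clinear_on_lincomb[OF \<phi> A_sub]) (auto intro: vA)
    moreover have "\<phi> (\<Sum>j<n. h (v p q * u k j) *\<^sub>C S (u j i)) =
        (\<Sum>j<n. h (v p q * u k j) *\<^sub>C \<phi> (S (u j i)))"
      using u by (intro clinear_on_lincomb[OF \<phi> A_sub]) (auto intro: uA S_in_A)
    ultimately show "h (lconv G \<phi> (v p q) * u k i) = h (v p q * lconv G (\<lambda>x. \<phi> (S x)) (u k i))"
      using u v by (simp add: lconv_coef \<phi> S_lin sum_distrib_left sum_distrib_right h_sum h_scale
          scaleC_mult_left scaleC_mult_right scaleC_complex_def mult.commute)
  qed (auto intro!: clinear_on_compose[OF _ _ h_lin] clinear_on_intros lconv_clinear lconv_in_A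
      mult_in_A vA v S_lin \<phi>)
qed (auto intro!: clinear_on_compose[OF _ _ h_lin] clinear_on_intros lconv_clinear lconv_in_A
      mult_in_A S_lin \<phi> ab)

section \<open>Symmetry of functionals and Woronowicz characters\<close>

lemma f_lin: "lin (f z)" and f_character: "character (f z)" and f_one: "f z 1 = 1"
  using woronowicz by (auto simp: woronowicz_characters_def character_def)

lemma f_holomorphic: "a \<in> A \<Longrightarrow> (\<lambda>z. f z a) holomorphic_on UNIV"
  and f_0: "a \<in> A \<Longrightarrow> f 0 a = \<epsilon> a"
  and f_conv: "a \<in> A \<Longrightarrow> conv G (f w) (f z) a = f (w + z) a"
  and f_S: "a \<in> A \<Longrightarrow> f z (S a) = f (- z) a"
  and f_star: "a \<in> A \<Longrightarrow> f (cnj z) (star a) = cnj (f (- z) a)"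
  using woronowicz by (auto simp: woronowicz_characters_def)

lemma lconv_f_f: "a \<in> A \<Longrightarrow> lconv G (f z) (lconv G (f w) a) = lconv G (f (z + w)) a"
  by (simp add: lconv_lconv f_lin) (rule lconv_cong; simp add: f_lin conv_clinear f_conv)

lemma rconv_f_f: "a \<in> A \<Longrightarrow> rconv G (rconv G a (f w)) (f z) = rconv G a (f (w + z))"
  by (simp add: rconv_rconv f_lin) (rule rconv_cong; simp add: f_lin conv_clinear f_conv)

lemma lconv_f_0: "a \<in> A \<Longrightarrow> lconv G (f 0) a = a"
  using lconv_cong[of "f 0" \<epsilon> a] by (simp add: f_lin \<epsilon>_lin f_0 lconv_counit)

lemma rconv_f_0: "a \<in> A \<Longrightarrow> rconv G a (f 0) = a"
  using rconv_cong[of "f 0" \<epsilon> a] by (simp add: f_lin \<epsilon>_lin f_0 rconv_counit)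

section \<open>The modular group on the Hopf algebra\<close>

abbreviation "\<sigma> \<equiv> modular G f"

lemma modular_in_A: "a \<in> A \<Longrightarrow> \<sigma> z a \<in> A"
  by (simp add: modular_def lconv_in_A rconv_in_A f_lin)

lemma modular_clinear: "clinear_on A (\<sigma> z)"
  unfolding modular_def
  by (intro rconv_clinear_compose lconv_clinear f_lin lconv_in_A; assumption)

lemma modular_mult: "a \<in> A \<Longrightarrow> b \<in> A \<Longrightarrow> \<sigma> z (a * b) = \<sigma> z a * \<sigma> z b"
  by (simp add: modular_def lconv_mult rconv_mult f_character lconv_in_A f_lin)

lemma modular_modular: "a \<in> A \<Longrightarrow> \<sigma> z (\<sigma> w a) = \<sigma> (z + w) a"
  unfolding modular_def
  by (simp add: lconv_rconv lconv_f_f rconv_f_f lconv_in_A f_lin distrib_left add.commute)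

lemma modular_0: "a \<in> A \<Longrightarrow> \<sigma> 0 a = a"
  by (simp add: modular_def lconv_f_0 rconv_f_0)

lemma haar_modular: "a \<in> A \<Longrightarrow> h (\<sigma> z a) = h a"
  by (simp add: modular_def haar_lconv haar_rconv f_lin f_one lconv_in_A)

lemma modular_star:
  assumes "a \<in> A"
  shows "star (\<sigma> z a) = \<sigma> (cnj z) (star a)"
proof -
  \<comment> \<open>This is \<open>f_star\<close> at the parameter \<open>- (\<i> * z)\<close>,
    whose conjugate is \<open>\<i> * cnj z\<close>.\<close>
  have eq: "cnj (f (\<i> * z) (star x)) = f (\<i> * cnj z) x" if "x \<in> A" for x
    using f_star[OF star_in_A[OF that], of "- (\<i> * z)"] by (simp add: star_star)
  have lin: "lin (\<lambda>x. cnj (f (\<i> * z) (star x)))"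
    by (intro lin_star f_lin)
  have "star (\<sigma> z a) = rconv G (lconv G (\<lambda>x. cnj (f (\<i> * z) (star x))) (star a))
      (\<lambda>x. cnj (f (\<i> * z) (star x)))"
    using assms by (simp add: modular_def lconv_star rconv_star f_lin lconv_in_A)
  also have "\<dots> = rconv G (lconv G (\<lambda>x. cnj (f (\<i> * z) (star x))) (star a)) (f (\<i> * cnj z))"
    by (intro rconv_cong lin f_lin eq lconv_in_A star_in_A assms)
  also have "lconv G (\<lambda>x. cnj (f (\<i> * z) (star x))) (star a) = lconv G (f (\<i> * cnj z)) (star a)"
    by (intro lconv_cong lin f_lin eq lconv_in_A star_in_A assms)
  finally show ?thesis
    by (simp add: modular_def)
qed

text \<open>Since \<open>\<i> * (- \<i>) = 1\<close>, the automorphism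
  \<open>\<sigma> (- \<i>)\<close> is the two-sided action of \<open>f 1\<close> in the modular
  property of the characters.\<close>

lemma haar_kms: "a \<in> A \<Longrightarrow> b \<in> A \<Longrightarrow> h (a * b) = h (b * \<sigma> (- \<i>) a)"
  using woronowicz by (simp add: woronowicz_characters_def modular_def)

section \<open>The unitary antipode and reversal of convolution\<close>

abbreviation "R \<equiv> unitary_antipode G S f"

lemma unitary_antipode_clinear: "clinear_on A R"
  unfolding unitary_antipode_def
  by (intro clinear_on_compose[OF _ _ S_clinear] rconv_clinear_compose lconv_clinear f_lin
      rconv_in_A lconv_in_A; assumption)

lemma unitary_antipode_in_A: "a \<in> A \<Longrightarrow> R a \<in> A"
  by (simp add: unitary_antipode_def S_in_A rconv_in_A lconv_in_A f_lin)

text \<open>Dually, composition with \<open>R\<close> is composition with \<open>S\<close> followed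
  by conjugation in the convolution algebra by \<open>f (1/2)\<close>. It is written with nested
  actions so that further convolutions can be composed.\<close>

lemma functional_unitary_antipode:
  assumes "lin \<psi>" "a \<in> A"
  shows "\<psi> (R a) = f (- 1/2) (lconv G (\<lambda>x. \<psi> (S x)) (lconv G (f (1/2)) a))"
  unfolding unitary_antipode_def
  using assms by (simp add: conv_rconv[where \<nu> = "\<lambda>x. \<psi> (S x)"] conv_lconv S_lin f_lin lconv_in_A
      del: minus_divide_left)

text \<open>Collects what \<open>S\<close> and \<open>R\<close> share, so that the passage to
  convolution exponentials is carried out once for both.\<close>

definition reverses_conv :: "('a \<Rightarrow> 'a) \<Rightarrow> bool" where
  "reverses_conv \<Theta> \<longleftrightarrow> clinear_on A \<Theta> \<and> (\<forall>a\<in>A. \<Theta> a \<in> A) \<and> (\<forall>a\<in>A. \<epsilon> (\<Theta> a) = \<epsilon> a) \<and>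
     (\<forall>\<mu> \<nu>. lin \<mu> \<longrightarrow> lin \<nu> \<longrightarrow>
        (\<forall>a\<in>A. conv G \<mu> \<nu> (\<Theta> a) = conv G (\<lambda>x. \<nu> (\<Theta> x)) (\<lambda>x. \<mu> (\<Theta> x)) a))"

text \<open>The counit is \<open>f 0\<close>, and \<open>f_S\<close> replaces the parameter 0 by its
  negative.\<close>

lemma counit_S: "a \<in> A \<Longrightarrow> \<epsilon> (S a) = \<epsilon> a"
  using f_S[of a 0] f_0[of a] f_0[of "S a"] by (simp add: S_in_A)

lemma reverses_conv_S: "reverses_conv S"
  by (simp add: reverses_conv_def S_clinear S_in_A conv_S counit_S)

text \<open>\<open>S\<close> reverses convolution, and the conjugations by \<open>f (1/2)\<close>
  cancel between the two factors.\<close>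

lemma reverses_conv_unitary_antipode: "reverses_conv R"
proof -
  have "\<epsilon> (R a) = \<epsilon> a" if a: "a \<in> A" for a
  proof -
    have "lconv G (\<lambda>x. \<epsilon> (S x)) (lconv G (f (1/2)) a) = lconv G \<epsilon> (lconv G (f (1/2)) a)"
      using a by (intro lconv_cong) (auto simp: S_lin \<epsilon>_lin counit_S lconv_in_A f_lin)
    then have "\<epsilon> (R a) = f (- 1/2) (lconv G (f (1/2)) a)"
      using a by (simp add: functional_unitary_antipode \<epsilon>_lin lconv_counit lconv_in_A f_lin)
    also have "\<dots> = \<epsilon> a"
      using a by (simp add: conv_lconv f_lin f_conv f_0)
    finally show ?thesis .
  qed
  moreover have "conv G \<mu> \<nu> (R a) = conv G (\<lambda>x. \<nu> (R x)) (\<lambda>x. \<mu> (R x)) a"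
    if lin: "lin \<mu>" "lin \<nu>" and a: "a \<in> A" for \<mu> \<nu> a
  proof -
    let ?g = "f (1/2)" and ?g' = "f (- 1/2)" and ?M = "\<lambda>x. \<mu> (S x)" and ?N = "\<lambda>x. \<nu> (S x)"
    note lins = lin f_lin S_lin conv_clinear clinear_on_compose[OF unitary_antipode_clinear
        unitary_antipode_in_A]
    have "conv G \<mu> \<nu> (R a) = ?g' (lconv G (\<lambda>x. conv G \<mu> \<nu> (S x)) (lconv G ?g a))"
      using a by (intro functional_unitary_antipode lins)
    also have "lconv G (\<lambda>x. conv G \<mu> \<nu> (S x)) (lconv G ?g a) = lconv G (conv G ?N ?M) (lconv G ?g a)"
      using a by (intro lconv_cong lins lconv_in_A conv_S)
    also have "\<dots> = lconv G ?N (lconv G ?M (lconv G ?g a))"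
      using a by (intro lconv_lconv[symmetric] lins lconv_in_A)
    finally have 1: "conv G \<mu> \<nu> (R a) = ?g' (lconv G ?N (lconv G ?M (lconv G ?g a)))" .
    have "lconv G (\<lambda>x. \<mu> (R x)) a = lconv G (conv G ?g' (conv G ?M ?g)) a"
      using a by (intro lconv_cong) (auto intro!: lins simp: functional_unitary_antipode lin
          conv_lconv[symmetric] lconv_lconv[symmetric] f_lin S_lin conv_clinear lconv_in_A)
    also have "\<dots> = lconv G ?g' (lconv G ?M (lconv G ?g a))"
      using a by (simp add: lconv_lconv[symmetric] lins lconv_in_A)
    \<comment> \<open>\<open>f (1/2)\<close> and \<open>f (- 1/2)\<close> meet here in the middle of
      the product and cancel.\<close>
    finally have "lconv G ?g (lconv G (\<lambda>x. \<mu> (R x)) a) = lconv G ?M (lconv G ?g a)"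
      using a by (simp add: lconv_f_f lconv_in_A lins lconv_f_0)
    moreover have "conv G (\<lambda>x. \<nu> (R x)) (\<lambda>x. \<mu> (R x)) a = \<nu> (R (lconv G (\<lambda>x. \<mu> (R x)) a))"
      using a by (intro conv_lconv[symmetric] lins)
    ultimately show ?thesis
      using a 1 by (simp add: functional_unitary_antipode lconv_in_A lins)
  qed
  ultimately show ?thesis
    by (simp add: reverses_conv_def unitary_antipode_clinear unitary_antipode_in_A)
qed

section \<open>Symmetry of convolution operators with respect to the Haar state\<close>

text \<open>Strong invariance brings both sides to the form
  \<open>h (a * lconv G \<theta> b)\<close> with two functionals in place of \<theta>, and
  \<open>haar_separating\<close> compares these.\<close>

lemma haar_symmetric_iff:
  assumes \<psi>: "lin \<psi>"
  shows "(\<forall>a\<in>A. \<forall>b\<in>A. h (a * lconv G \<psi> b) = h (lconv G \<psi> a * b)) \<longleftrightarrow> (\<forall>a\<in>A. \<psi> (S a) = \<psi> a)"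
    (is "?L \<longleftrightarrow> ?R")
proof
  assume L: ?L
  show ?R
  proof
    fix a assume a: "a \<in> A"
    let ?\<theta> = "\<lambda>x. \<psi> (S x) - \<psi> x"
    have "?\<theta> a = 0"
    proof (rule haar_separating[OF _ _ a])
      show "lin ?\<theta>" by (intro clinear_on_intros S_lin \<psi>)
      fix a b assume "a \<in> A" "b \<in> A"
      then show "h (a * lconv G ?\<theta> b) = 0"
        using L by (simp add: lconv_diff S_lin \<psi> right_diff_distrib h_diff haar_strong_invariance)
    qed
    then show "\<psi> (S a) = \<psi> a" by simp
  qed
next
  assume R: ?R
  have "lconv G (\<lambda>x. \<psi> (S x)) b = lconv G \<psi> b" if "b \<in> A" for b
    using R that by (intro lconv_cong S_lin \<psi>) auto
  then show ?L
    by (simp add: haar_strong_invariance \<psi>)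
qed

text \<open>Convolving on the left with \<open>f (1/2)\<close> or with its inverse
  \<open>f (- 1/2)\<close> passes between the two equations.\<close>

lemma functional_unitary_antipode_eq_iff:
  assumes \<psi>: "lin \<psi>"
  shows "(\<forall>a\<in>A. \<psi> (R a) = \<psi> a) \<longleftrightarrow>
    (\<forall>a\<in>A. conv G (f (1/2)) \<psi> a = conv G (\<lambda>x. \<psi> (S x)) (f (1/2)) a)"
    (is "?L \<longleftrightarrow> ?R")
proof -
  let ?g = "f (1/2)" and ?g' = "f (- 1/2)" and ?P = "\<lambda>x. \<psi> (S x)"
  note lins = \<psi> f_lin S_lin conv_clinear
  have R: "\<psi> (R a) = conv G ?g' (conv G ?P ?g) a" if "a \<in> A" for a
    using that by (simp add: functional_unitary_antipode conv_lconv[symmetric]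
        lconv_lconv[symmetric] lconv_in_A lins)
  have gg': "conv G ?g' ?g a = \<epsilon> a" "conv G ?g ?g' a = \<epsilon> a" if "a \<in> A" for a
    using that by (simp_all add: f_conv f_0)
  show ?thesis
  proof
    assume L: ?L
    show ?R
    proof
      fix a assume a: "a \<in> A"
      have "conv G ?g \<psi> a = conv G ?g (conv G ?g' (conv G ?P ?g)) a"
        using L by (intro conv_cong lins a) (auto simp: R)
      also have "\<dots> = conv G (conv G ?g ?g') (conv G ?P ?g) a"
        using a by (simp add: conv_assoc lins)
      also have "\<dots> = conv G \<epsilon> (conv G ?P ?g) a"
        by (intro conv_cong lins a gg' \<epsilon>_lin) auto
      finally show "conv G ?g \<psi> a = conv G ?P ?g a"
        using a by (simp add: conv_counit_left lins)
    qed
  next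
    assume *: ?R
    show ?L
    proof
      fix a assume a: "a \<in> A"
      have "\<psi> (R a) = conv G ?g' (conv G ?g \<psi>) a"
        unfolding R[OF a] using * by - (rule conv_cong, auto intro!: lins a)
      also have "\<dots> = conv G (conv G ?g' ?g) \<psi> a"
        using a by (simp add: conv_assoc lins)
      also have "\<dots> = conv G \<epsilon> \<psi> a"
        by (intro conv_cong lins a gg' \<epsilon>_lin) auto
      finally show "\<psi> (R a) = \<psi> a"
        using a by (simp add: conv_counit_left lins)
    qed
  qed
qed

text \<open>The whole product is moved by \<open>\<sigma> (- z)\<close>, which is multiplicative and
  preserves \<open>h\<close>.\<close>

lemma haar_modular_adjoint:
  assumes "a \<in> A" "b \<in> A"
  shows "h (\<sigma> z a * b) = h (a * \<sigma> (- z) b)"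
  using haar_modular[of "\<sigma> z a * b" "- z"] assms
  by (simp add: mult_in_A modular_in_A modular_mult modular_modular modular_0)

text \<open>All operators are moved onto \<open>b\<close>: the modular map by invariance of
  \<open>h\<close>, the convolution operator by strong invariance. The two sides then differ only in
  the functionals compared in \<open>functional_unitary_antipode_eq_iff\<close>.\<close>

lemma haar_kms_symmetric_iff:
  assumes \<psi>: "lin \<psi>"
  shows "(\<forall>a\<in>A. \<forall>b\<in>A. h (\<sigma> (\<i>/2) a * lconv G \<psi> b) = h (lconv G \<psi> a * \<sigma> (- \<i>/2) b)) \<longleftrightarrow>
    (\<forall>a\<in>A. \<psi> (R a) = \<psi> a)"
    (is "?L \<longleftrightarrow> _")
proof -
  let ?g = "f (1/2)" and ?g' = "f (- 1/2)" and ?P = "\<lambda>x. \<psi> (S x)"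
  let ?\<theta> = "\<lambda>x. conv G ?g \<psi> x - conv G ?P ?g x"
  note lins = \<psi> f_lin S_lin conv_clinear
  have \<theta>: "lin ?\<theta>"
    by (intro clinear_on_intros lins)
  have half: "\<sigma> (- \<i>/2) b = rconv G (lconv G ?g b) ?g" for b
    by (simp add: modular_def)
  have diff: "h (\<sigma> (\<i>/2) a * lconv G \<psi> b) - h (lconv G \<psi> a * \<sigma> (- \<i>/2) b) =
      h (a * rconv G (lconv G ?\<theta> b) ?g)" if ab: "a \<in> A" "b \<in> A" for a b
  proof -
    have "h (\<sigma> (\<i>/2) a * lconv G \<psi> b) = h (a * \<sigma> (- \<i>/2) (lconv G \<psi> b))"
      using haar_modular_adjoint[OF ab(1) lconv_in_A[OF \<psi> ab(2)], of "\<i>/2"] by simp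
    also have "\<dots> = h (a * rconv G (lconv G (conv G ?g \<psi>) b) ?g)"
      unfolding half using ab by (simp add: lconv_lconv lins)
    finally have 1: "h (\<sigma> (\<i>/2) a * lconv G \<psi> b) =
        h (a * rconv G (lconv G (conv G ?g \<psi>) b) ?g)" .
    have "h (lconv G \<psi> a * \<sigma> (- \<i>/2) b) = h (a * lconv G ?P (\<sigma> (- \<i>/2) b))"
      using ab by (intro haar_strong_invariance \<psi> modular_in_A)
    also have "\<dots> = h (a * rconv G (lconv G (conv G ?P ?g) b) ?g)"
      unfolding half using ab by (simp add: lconv_rconv lconv_lconv lins lconv_in_A)
    finally have 2: "h (lconv G \<psi> a * \<sigma> (- \<i>/2) b) =
        h (a * rconv G (lconv G (conv G ?P ?g) b) ?g)" .
    show ?thesis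
      using ab unfolding 1 2 by (simp add: lconv_diff lins h_diff right_diff_distrib
          clinear_on_diff[OF rconv_clinear A_sub] lconv_in_A)
  qed
  have "?L \<longleftrightarrow> (\<forall>a\<in>A. \<forall>b\<in>A. h (a * rconv G (lconv G ?\<theta> b) ?g) = 0)"
    by (simp add: diff[symmetric])
  also have "\<dots> \<longleftrightarrow> (\<forall>a\<in>A. ?\<theta> a = 0)"
  proof
    assume 0: "\<forall>a\<in>A. \<forall>b\<in>A. h (a * rconv G (lconv G ?\<theta> b) ?g) = 0"
    show "\<forall>a\<in>A. ?\<theta> a = 0"
    proof
      fix a assume "a \<in> A"
      then show "?\<theta> a = 0"
      proof (rule haar_separating[OF \<theta>, rotated])
        fix a b assume ab: "a \<in> A" "b \<in> A"
        \<comment> \<open>The outer right action of \<open>f (1/2)\<close> is invertible and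
          commutes with left actions, so it is removed by replacing \<open>b\<close> with
          \<open>rconv G b ?g'\<close>.\<close>
        have "rconv G (lconv G ?\<theta> (rconv G b ?g')) ?g = lconv G ?\<theta> (rconv G (rconv G b ?g') ?g)"
          using ab by (intro lconv_rconv[symmetric] \<theta> f_lin rconv_in_A)
        also have "\<dots> = lconv G ?\<theta> b"
          using ab by (simp add: rconv_f_f rconv_f_0)
        finally have eq: "rconv G (lconv G ?\<theta> (rconv G b ?g')) ?g = lconv G ?\<theta> b" .
        show "h (a * lconv G ?\<theta> b) = 0"
          unfolding eq[symmetric] by (rule 0[rule_format, OF ab(1) rconv_in_A[OF f_lin ab(2)]])
      qed
    qed
  next
    assume 0: "\<forall>a\<in>A. ?\<theta> a = 0"
    have "lconv G ?\<theta> b = 0" if b: "b \<in> A" for b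
    proof -
      have "lconv G (conv G ?g \<psi>) b = lconv G (conv G ?P ?g) b"
        using 0 by (intro lconv_cong lins b) auto
      then show ?thesis
        using b by (simp add: lconv_diff lins)
    qed
    moreover have "rconv G 0 ?g = 0"
      by (rule clinear_on_zero[OF rconv_clinear[OF f_lin] A_sub])
    ultimately show "\<forall>a\<in>A. \<forall>b\<in>A. h (a * rconv G (lconv G ?\<theta> b) ?g) = 0"
      by (simp add: h_zero)
  qed
  finally show ?thesis
    by (simp add: functional_unitary_antipode_eq_iff[OF \<psi>])
qed

text \<open>Links the form of KMS symmetry used for semigroups with the one used for generators,
  through the KMS property of \<open>h\<close>.\<close>

lemma haar_kms_symmetric_shift:
  assumes \<psi>: "lin \<psi>"
  shows "(\<forall>a\<in>A. \<forall>b\<in>A. h (a * lconv G \<psi> b) = h (\<sigma> (\<i>/2) b * lconv G \<psi> (\<sigma> (- \<i>/2) a))) \<longleftrightarrow>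
    (\<forall>a\<in>A. \<forall>b\<in>A. h (\<sigma> (\<i>/2) a * lconv G \<psi> b) = h (lconv G \<psi> a * \<sigma> (- \<i>/2) b))"
    (is "?L \<longleftrightarrow> ?R")
proof -
  \<comment> \<open>The automorphism \<open>\<sigma> (- \<i>)\<close> is split into two halves, one
    of which is matched with the argument of \<open>lconv G \<psi>\<close>.\<close>
  have *: "h (a * lconv G \<psi> b) = h (lconv G \<psi> b * \<sigma> (- \<i>/2) (\<sigma> (- \<i>/2) a))"
    if "a \<in> A" "b \<in> A" for a b
    using that haar_kms[OF that(1) lconv_in_A[OF \<psi> that(2)]] by (simp add: modular_modular)
  show ?thesis
  proof
    assume L: ?L
    show ?R
    proof (intro ballI)
      fix a b assume ab: "a \<in> A" "b \<in> A"
      have "\<sigma> (- \<i>/2) (\<sigma> (\<i>/2) b) = b"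
        using ab by (simp add: modular_modular modular_0)
      with L[rule_format, of "\<sigma> (\<i>/2) b" a] *[of "\<sigma> (\<i>/2) b" a] ab
      show "h (\<sigma> (\<i>/2) a * lconv G \<psi> b) = h (lconv G \<psi> a * \<sigma> (- \<i>/2) b)"
        by (simp add: modular_in_A)
    qed
  next
    assume R: ?R
    then show ?L
      using * modular_in_A by metis
  qed
qed

section \<open>Convolution powers and convolution exponentials\<close>

context
  fixes \<phi> assumes \<phi>_lin: "lin \<phi>"
begin

lemma conv_power_lin: "lin (conv_power G \<epsilon> \<phi> k)"
  by (induction k) (simp_all add: \<epsilon>_lin conv_clinear \<phi>_lin)

text \<open>The recursion puts \<phi> on the left, while a reversal of convolution moves it to the
  right.\<close>

lemma conv_power_commute:
  "a \<in> A \<Longrightarrow> conv G (conv_power G \<epsilon> \<phi> k) \<phi> a = conv G \<phi> (conv_power G \<epsilon> \<phi> k) a"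
proof (induction k arbitrary: a)
  case 0
  then show ?case by (simp add: conv_counit_left conv_counit_right \<phi>_lin)
next
  case (Suc k)
  have "conv G (conv_power G \<epsilon> \<phi> (Suc k)) \<phi> a = conv G \<phi> (conv G (conv_power G \<epsilon> \<phi> k) \<phi>) a"
    using Suc.prems by (simp add: conv_assoc \<phi>_lin conv_power_lin)
  also have "\<dots> = conv G \<phi> (conv_power G \<epsilon> \<phi> (Suc k)) a"
    using Suc by (intro conv_cong) (auto intro!: \<phi>_lin conv_power_lin conv_clinear)
  finally show ?case .
qed

lemma conv_power_reverse:
  assumes \<Theta>: "reverses_conv \<Theta>" "\<forall>a\<in>A. \<phi> (\<Theta> a) = \<phi> a"
  shows "a \<in> A \<Longrightarrow> conv_power G \<epsilon> \<phi> k (\<Theta> a) = conv_power G \<epsilon> \<phi> k a"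
proof (induction k arbitrary: a)
  case 0
  then show ?case using \<Theta> by (simp add: reverses_conv_def)
next
  case (Suc k)
  let ?P = "conv_power G \<epsilon> \<phi> k"
  have lin: "lin (\<lambda>x. \<mu> (\<Theta> x))" if "lin \<mu>" for \<mu>
    using \<Theta> that by (auto simp: reverses_conv_def intro: clinear_on_compose)
  have "conv G \<phi> ?P (\<Theta> a) = conv G (\<lambda>x. ?P (\<Theta> x)) (\<lambda>x. \<phi> (\<Theta> x)) a"
    using \<Theta> Suc.prems \<phi>_lin conv_power_lin by (auto simp: reverses_conv_def)
  also have "\<dots> = conv G ?P \<phi> a"
    using \<Theta> Suc by (intro conv_cong lin \<phi>_lin conv_power_lin) auto
  finally show ?case
    using conv_power_commute[OF Suc.prems] by simp
qed

text \<open>On coefficients, convolution powers are powers of the scalar matrix of \<phi>, hence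
  grow at most geometrically. The constants may depend on \<open>a\<close>.\<close>

lemma conv_power_bound:
  assumes "a \<in> A"
  shows "\<exists>K C. 0 \<le> K \<and> 0 \<le> C \<and> (\<forall>k. cmod (conv_power G \<epsilon> \<phi> k a) \<le> K * C ^ k)"
  using assms
proof (induction a rule: A_induct)
  case (coef n u i j)
  \<comment> \<open>\<open>K\<close> dominates every entry of the matrix of \<epsilon>, and
    \<open>C\<close> dominates every row sum for \<phi>.\<close>
  define K where "K = (\<Sum>i<n. \<Sum>j<n. cmod (\<epsilon> (u i j)))"
  define C where "C = (\<Sum>i<n. \<Sum>j<n. cmod (\<phi> (u i j)))"
  have KC: "0 \<le> K" "0 \<le> C"
    by (simp_all add: K_def C_def sum_nonneg)
  have "cmod (conv_power G \<epsilon> \<phi> k (u i j)) \<le> K * C ^ k" if "i < n" "j < n" for k i j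
    using that
  proof (induction k arbitrary: i j)
    case 0
    have "cmod (\<epsilon> (u i j)) \<le> (\<Sum>j<n. cmod (\<epsilon> (u i j)))"
      using 0 by (intro member_le_sum) auto
    also have "\<dots> \<le> K"
      unfolding K_def using 0
      by (intro member_le_sum[where f = "\<lambda>i. \<Sum>j<n. cmod (\<epsilon> (u i j))"]) (auto intro: sum_nonneg)
    finally show ?case by simp
  next
    case (Suc k)
    have "cmod (conv_power G \<epsilon> \<phi> (Suc k) (u i j)) \<le>
        (\<Sum>m<n. cmod (\<phi> (u i m)) * cmod (conv_power G \<epsilon> \<phi> k (u m j)))"
      using coef(1) Suc.prems
      by (auto simp: conv_coef \<phi>_lin conv_power_lin norm_mult intro: order_trans[OF norm_sum])
    also have "\<dots> \<le> (\<Sum>m<n. cmod (\<phi> (u i m)) * (K * C ^ k))"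
      using Suc by (intro sum_mono mult_left_mono) auto
    also have "\<dots> \<le> C * (K * C ^ k)"
      unfolding sum_distrib_right[symmetric] C_def using Suc.prems KC
      by (intro mult_right_mono member_le_sum[where f = "\<lambda>i. \<Sum>j<n. cmod (\<phi> (u i j))"])
        (auto intro: sum_nonneg simp: C_def[symmetric])
    finally show ?case by (simp add: mult_ac)
  qed
  with KC coef show ?case by blast
next
  case (add x y)
  then obtain K C K' C' where *: "0 \<le> K" "0 \<le> C" "0 \<le> K'" "0 \<le> C'"
    "\<And>k. cmod (conv_power G \<epsilon> \<phi> k x) \<le> K * C ^ k" "\<And>k. cmod (conv_power G \<epsilon> \<phi> k y) \<le> K' * C' ^ k"
    by blast
  have "cmod (conv_power G \<epsilon> \<phi> k (x + y)) \<le> (K + K') * (max C C') ^ k" for k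
  proof -
    have "cmod (conv_power G \<epsilon> \<phi> k (x + y)) \<le> K * C ^ k + K' * C' ^ k"
      unfolding clinear_on_add[OF conv_power_lin add(1,2)]
      by (intro order_trans[OF norm_triangle_ineq] add_mono *)
    also have "\<dots> \<le> K * (max C C') ^ k + K' * (max C C') ^ k"
      using * by (intro add_mono mult_left_mono power_mono) auto
    finally show ?thesis by (simp add: distrib_right)
  qed
  with * show ?case
    by (intro exI[of _ "K + K'"] exI[of _ "max C C'"]) auto
next
  case (scale c x)
  then obtain K C where *: "0 \<le> K" "0 \<le> C" "\<And>k. cmod (conv_power G \<epsilon> \<phi> k x) \<le> K * C ^ k"
    by blast
  then have "cmod (conv_power G \<epsilon> \<phi> k (c *\<^sub>C x)) \<le> (cmod c * K) * C ^ k" for k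
    unfolding clinear_on_scale[OF conv_power_lin scale(1)]
    by (simp add: scaleC_complex_def norm_mult mult.assoc mult_left_mono)
  with * show ?case
    by (metis mult_nonneg_nonneg norm_ge_zero)
qed

text \<open>The terms are dominated by those of \<open>K\<close> times an exponential series.
  Complex \<open>z\<close> is allowed because the series is later differentiated at 0.\<close>

lemma conv_exp_summable:
  assumes "a \<in> A"
  shows "summable (\<lambda>k. conv_power G \<epsilon> \<phi> k a / fact k * z ^ k)"
proof -
  obtain K C where *: "0 \<le> K" "0 \<le> C" "\<And>k. cmod (conv_power G \<epsilon> \<phi> k a) \<le> K * C ^ k"
    using conv_power_bound[OF assms] by blast
  show ?thesis
  proof (rule summable_comparison_test')
    show "summable (\<lambda>k. K * ((C * cmod z) ^ k /\<^sub>R fact k))"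
      by (intro summable_mult summable_exp_generic)
    show "norm (conv_power G \<epsilon> \<phi> k a / fact k * z ^ k) \<le> K * ((C * cmod z) ^ k /\<^sub>R fact k)" for k
      using mult_right_mono[OF *(3)[of k], of "cmod z ^ k / fact k"]
      by (simp add: norm_mult norm_divide norm_power power_mult_distrib field_simps)
  qed
qed

lemma conv_exp_altdef:
  "conv_exp G \<epsilon> \<phi> t a = (\<Sum>k. conv_power G \<epsilon> \<phi> k a / fact k * of_real t ^ k)"
  unfolding conv_exp_def by (simp add: mult.commute)

lemma conv_exp_lin: "lin (conv_exp G \<epsilon> \<phi> t)"
proof (rule clinear_onI)
  fix x y assume xy: "x \<in> A" "y \<in> A"
  show "conv_exp G \<epsilon> \<phi> t (x + y) = conv_exp G \<epsilon> \<phi> t x + conv_exp G \<epsilon> \<phi> t y"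
    unfolding conv_exp_altdef suminf_add[OF conv_exp_summable[OF xy(1)] conv_exp_summable[OF xy(2)]]
    by (simp add: clinear_on_add[OF conv_power_lin xy] add_divide_distrib distrib_right)
next
  fix c x assume x: "x \<in> A"
  show "conv_exp G \<epsilon> \<phi> t (c *\<^sub>C x) = c *\<^sub>C conv_exp G \<epsilon> \<phi> t x"
    unfolding conv_exp_altdef scaleC_complex_def suminf_mult[OF conv_exp_summable[OF x], symmetric]
    by (simp add: clinear_on_scale[OF conv_power_lin x] scaleC_complex_def mult.assoc)
qed

text \<open>One direction is termwise on convolution powers. For the other, the difference of the
  two power series vanishes for all nonnegative times, and its linear coefficient is the difference
  of the values of \<phi>.\<close>

lemma conv_exp_reverse_iff:
  assumes \<Theta>: "reverses_conv \<Theta>"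
  shows "(\<forall>t\<ge>0. \<forall>a\<in>A. conv_exp G \<epsilon> \<phi> t (\<Theta> a) = conv_exp G \<epsilon> \<phi> t a) \<longleftrightarrow>
    (\<forall>a\<in>A. \<phi> (\<Theta> a) = \<phi> a)"
proof
  assume eq: "\<forall>t\<ge>0. \<forall>a\<in>A. conv_exp G \<epsilon> \<phi> t (\<Theta> a) = conv_exp G \<epsilon> \<phi> t a"
  show "\<forall>a\<in>A. \<phi> (\<Theta> a) = \<phi> a"
  proof
    fix a assume a: "a \<in> A"
    then have \<Theta>a: "\<Theta> a \<in> A"
      using \<Theta> by (simp add: reverses_conv_def)
    let ?c = "\<lambda>k. conv_power G \<epsilon> \<phi> k (\<Theta> a) / fact k - conv_power G \<epsilon> \<phi> k a / fact k"
    note sm = conv_exp_summable[OF \<Theta>a] conv_exp_summable[OF a]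
    have "?c 1 = 0"
    proof (rule power_series_eq_0_right_imp_coeff_1_eq_0)
      show "summable (\<lambda>k. ?c k * y ^ k)" for y
        using summable_diff[OF sm] by (simp add: left_diff_distrib)
      show "(\<Sum>k. ?c k * of_real t ^ k) = 0" if "0 \<le> t" for t :: real
        using eq a that suminf_diff[OF sm, of "of_real t" "of_real t"]
        by (simp add: left_diff_distrib conv_exp_altdef)
    qed
    then show "\<phi> (\<Theta> a) = \<phi> a"
      using a \<Theta>a by (simp add: conv_counit_right \<phi>_lin)
  qed
next
  assume "\<forall>a\<in>A. \<phi> (\<Theta> a) = \<phi> a"
  then show "\<forall>t\<ge>0. \<forall>a\<in>A. conv_exp G \<epsilon> \<phi> t (\<Theta> a) = conv_exp G \<epsilon> \<phi> t a"
    by (simp add: conv_exp_def conv_power_reverse[OF \<Theta>])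
qed

end

section \<open>Comparison of modular subalgebras\<close>

lemma continuous_on_haar: "continuous_on X F \<Longrightarrow> continuous_on X (\<lambda>x. h (F x))"
  by (rule bounded_linear.continuous_on[OF h_bounded])

lemma dense_eqI:
  fixes F H :: "'a \<Rightarrow> 'b::t2_space"
  assumes "continuous_on UNIV F" "continuous_on UNIV H" "\<And>a. a \<in> A \<Longrightarrow> F a = H a"
  shows "F x = H x"
proof -
  have "closure A \<subseteq> {x. F x = H x}"
    using assms by (intro closure_minimal closed_Collect_eq) auto
  then show ?thesis using dense by blast
qed

text \<open>With \<open>a\<close> kept in \<open>A\<close>, both sides are continuous in
  \<open>x\<close>.\<close>

lemma haar_kms_dense: "a \<in> A \<Longrightarrow> h (a * x) = h (x * \<sigma> (- \<i>) a)"
  by (rule dense_eqI[where F = "\<lambda>x. h (a * x)"]) (auto intro!: continuous_on_haar continuous_intros haar_kms)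

section \<open>Positivity of the Haar state\<close>

text \<open>Positivity at \<open>1 + x\<close> and at \<open>1 + \<i> *\<^sub>C x\<close> yields the
  imaginary and the real part of the equation.\<close>

lemma haar_star: "h (star x) = cnj (h x)"
proof -
  have pos: "Im (h (star x * x)) = 0" for x
    using h_pos[of x] by (simp add: complex_nonneg_Reals_iff)
  have "star (1 + x) * (1 + x) = 1 + x + star x + star x * x"
    by (simp add: star_add algebra_simps)
  then have 1: "Im (h x + h (star x)) = 0"
    using pos[of "1 + x"] pos[of x] by (simp add: h_add h_one)
  have "star (1 + \<i> *\<^sub>C x) * (1 + \<i> *\<^sub>C x) = 1 + \<i> *\<^sub>C x + (- \<i>) *\<^sub>C star x + star x * x"
    by (simp add: star_add star_scaleC algebra_simps scaleC_mult_left scaleC_mult_right scaleC_scaleC)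
  then have 2: "Im (\<i> * h x - \<i> * h (star x)) = 0"
    using pos[of "1 + \<i> *\<^sub>C x"] pos[of x] by (simp add: h_add h_diff h_one h_scale)
  from 1 2 show ?thesis
    by (simp add: complex_eq_iff)
qed

text \<open>A positive upper bound \<beta> replaces the value at \<open>star y * y\<close>, which
  may be 0 and could not be divided by.\<close>

lemma haar_cauchy_schwarz:
  assumes \<beta>: "Re (h (star y * y)) \<le> \<beta>" "0 < \<beta>"
  shows "(cmod (h (x * y)))\<^sup>2 \<le> Re (h (x * star x)) * \<beta>"
proof -
  define \<gamma> where "\<gamma> = h (x * y)"
  \<comment> \<open>This \<open>c\<close> minimizes the positive quadratic expression below when its
    leading coefficient is replaced by \<beta>.\<close>
  define c where "c = - cnj \<gamma> / of_real \<beta>"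
  have "h (star y * star x) = cnj \<gamma>"
    using haar_star[of "x * y"] by (simp add: star_mult \<gamma>_def)
  moreover have "star (star x + c *\<^sub>C y) * (star x + c *\<^sub>C y) =
      x * star x + c *\<^sub>C (x * y) + cnj c *\<^sub>C (star y * star x) + (c * cnj c) *\<^sub>C (star y * y)"
    by (simp add: star_add star_scaleC star_star algebra_simps scaleC_mult_left scaleC_mult_right
        scaleC_scaleC)
  ultimately have "h (star (star x + c *\<^sub>C y) * (star x + c *\<^sub>C y)) =
      h (x * star x) + c * \<gamma> + cnj c * cnj \<gamma> + (c * cnj c) * h (star y * y)"
    by (simp add: h_add h_scale \<gamma>_def)
  moreover have "c * \<gamma> = - of_real ((cmod \<gamma>)\<^sup>2 / \<beta>)" "cnj c * cnj \<gamma> = - of_real ((cmod \<gamma>)\<^sup>2 / \<beta>)"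
    "c * cnj c = of_real ((cmod \<gamma>)\<^sup>2 / \<beta>\<^sup>2)"
    by (simp_all add: c_def complex_norm_square[symmetric] mult.commute power2_eq_square
        flip: of_real_power)
  ultimately have "0 \<le> Re (h (x * star x)) - 2 * ((cmod \<gamma>)\<^sup>2 / \<beta>) +
      (cmod \<gamma>)\<^sup>2 / \<beta>\<^sup>2 * Re (h (star y * y))"
    using h_pos[of "star x + c *\<^sub>C y"] by (simp add: complex_nonneg_Reals_iff)
  also have "(cmod \<gamma>)\<^sup>2 / \<beta>\<^sup>2 * Re (h (star y * y)) \<le> (cmod \<gamma>)\<^sup>2 / \<beta>\<^sup>2 * \<beta>"
    using \<beta> by (intro mult_left_mono) auto
  finally show ?thesis
    using \<beta>(2) by (simp add: \<gamma>_def power2_eq_square field_simps)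
qed

section \<open>Entire orbits of the modular group\<close>

text \<open>The pair condition expresses \<open>F(s) = \<sigma>\<^sub>s(F(0))\<close> for the continuous extension of \<open>\<sigma>\<^sub>s\<close>
  to the C*-algebra, without assuming that this extension exists.\<close>

definition orbit :: "(complex \<Rightarrow> 'a) \<Rightarrow> bool" where
  "orbit F \<longleftrightarrow> entire_curve F \<and>
     (\<forall>s::real. (F 0, F (of_real s)) \<in> closure {(x, \<sigma> (of_real s) x) | x. x \<in> A})"

text \<open>The parameter \<open>z\<close> enters through scalars only, which reduces holomorphy of
  modular orbits to that of the characters.\<close>

lemma modular_coef:
  assumes u: "unitary_corep G n u" "i < n" "j < n"
  shows "\<sigma> z (u i j) =
    (\<Sum>k<n. \<Sum>l<n. (f (\<i> * z) (u k j) * f (\<i> * z) (u i l)) *\<^sub>C u l k)"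
  using u by (simp add: modular_def lconv_coef f_lin rconv_coef
      lincomb_coef[OF rconv_clinear[OF f_lin] u(1)] cvs.scale_sum_right scaleC_scaleC)

lemma f_holomorphic_compose: "a \<in> A \<Longrightarrow> (\<lambda>z. f (\<i> * z) a) holomorphic_on UNIV"
  using holomorphic_on_compose_gen[of "\<lambda>z. \<i> * z" UNIV "\<lambda>z. f z a" UNIV]
  by (auto simp: o_def f_holomorphic intro: holomorphic_intros)

lemma entire_curve_modular: "a \<in> A \<Longrightarrow> entire_curve (\<lambda>z. \<sigma> z a)"
proof (induction a rule: A_induct)
  case (coef n u i j)
  note uA = coef_in_A[OF coef(1)]
  have zero: "entire_curve (\<lambda>z. 0 :: 'a)"
    using entire_curve_holomorphic_scaleC[of "\<lambda>z. 0" "0::'a"] by simp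
  have sum: "entire_curve (\<lambda>z. \<Sum>i\<in>I. F i z)" if "finite I" "\<And>i. i \<in> I \<Longrightarrow> entire_curve (F i)"
    for I :: "nat set" and F :: "nat \<Rightarrow> complex \<Rightarrow> 'a"
    using that by (induction I rule: finite_induct) (auto intro: entire_curve_add zero)
  show ?case
    unfolding modular_coef[OF coef] using coef
    by (intro sum entire_curve_holomorphic_scaleC holomorphic_intros f_holomorphic_compose)
      (auto intro: uA)
next
  case (add x y)
  then show ?case
    by (simp add: clinear_on_add[OF modular_clinear] entire_curve_add)
next
  case (scale c x)
  then show ?case
    by (simp add: clinear_on_scale[OF modular_clinear] entire_curve_scale)
qed

lemma orbit_modular: "a \<in> A \<Longrightarrow> orbit (\<lambda>z. \<sigma> z a)"
  unfolding orbit_def by (auto simp: entire_curve_modular modular_0 intro!: subsetD[OF closure_subset])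

lemma orbit_sequence:
  assumes "orbit F"
  obtains x where "\<And>n. x n \<in> A" "x \<longlonglongrightarrow> F 0" "(\<lambda>n. \<sigma> (of_real s) (x n)) \<longlonglongrightarrow> F (of_real s)"
proof -
  have "(F 0, F (of_real s)) \<in> closure {(x, \<sigma> (of_real s) x) | x. x \<in> A}"
    using assms by (simp add: orbit_def)
  then obtain p where p: "\<forall>n. p n \<in> {(x, \<sigma> (of_real s) x) | x. x \<in> A}"
    "p \<longlonglongrightarrow> (F 0, F (of_real s))"
    unfolding closure_sequential by blast
  show thesis
  proof (rule that[of "\<lambda>n. fst (p n)"])
    show "fst (p n) \<in> A" for n
      using p(1)[rule_format, of n] by auto
    have "snd (p n) = \<sigma> (of_real s) (fst (p n))" for n
      using p(1)[rule_format, of n] by auto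
    then show "(\<lambda>n. \<sigma> (of_real s) (fst (p n))) \<longlonglongrightarrow> F (of_real s)"
      using tendsto_snd[OF p(2)] by simp
    show "(\<lambda>n. fst (p n)) \<longlonglongrightarrow> F 0"
      using tendsto_fst[OF p(2)] by simp
  qed
qed

text \<open>Allows an orbit from an arbitrary modular subalgebra to be compared with one from the
  Hopf algebra.\<close>

lemma orbit_diff:
  assumes "orbit F" "orbit H"
  shows "orbit (\<lambda>z. F z - H z)"
  unfolding orbit_def
proof (intro conjI allI)
  show "entire_curve (\<lambda>z. F z - H z)"
    using assms by (simp add: orbit_def entire_curve_diff)
  fix s :: real
  let ?\<Gamma> = "{(x, \<sigma> (of_real s) x) | x. x \<in> A}"
  obtain x where x: "\<And>n. x n \<in> A" "x \<longlonglongrightarrow> F 0"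
    "(\<lambda>n. \<sigma> (of_real s) (x n)) \<longlonglongrightarrow> F (of_real s)"
    using orbit_sequence[OF assms(1)] by blast
  obtain y where y: "\<And>n. y n \<in> A" "y \<longlonglongrightarrow> H 0"
    "(\<lambda>n. \<sigma> (of_real s) (y n)) \<longlonglongrightarrow> H (of_real s)"
    using orbit_sequence[OF assms(2)] by blast
  have "(\<lambda>n. (x n - y n, \<sigma> (of_real s) (x n - y n))) \<longlonglongrightarrow>
      (F 0 - H 0, F (of_real s) - H (of_real s))"
    unfolding clinear_on_diff[OF modular_clinear A_sub x(1) y(1)]
    by (intro tendsto_intros x y)
  moreover have "(x n - y n, \<sigma> (of_real s) (x n - y n)) \<in> ?\<Gamma>" for n
    using A_diff[OF x(1) y(1)] by blast
  ultimately show "(F 0 - H 0, F (of_real s) - H (of_real s)) \<in> closure ?\<Gamma>"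
    unfolding closure_sequential
    by (intro exI[of _ "\<lambda>n. (x n - y n, \<sigma> (of_real s) (x n - y n))"] conjI allI)
qed

text \<open>Invariance of \<open>h\<close> under the modular group, continued from real to complex
  parameters: both sides are entire in \<open>z\<close>.\<close>

lemma haar_orbit:
  assumes F: "orbit F" and y: "y \<in> A"
  shows "h (F z * \<sigma> z y) = h (F 0 * y)"
proof (rule entire_eq_if_eq_on_reals[where H = "\<lambda>z. h (F z * \<sigma> z y)" and
      K = "\<lambda>z. h (F 0 * y)"])
  \<comment> \<open>With a fixed right factor only \<open>F\<close> depends on \<open>z\<close>; the
    moving factor \<open>\<sigma> z y\<close> is afterwards a finite combination of fixed elements
    with entire scalar coefficients.\<close>
  have hol: "(\<lambda>z. h (F z * x)) holomorphic_on UNIV" for x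
  proof (rule entire_curve_compose_holomorphic[where g = "\<lambda>v. h (v * x)"])
    show "bounded_linear (\<lambda>v. h (v * x))"
      by (rule bounded_linear_compose[OF h_bounded bounded_linear_mult_left])
  qed (use F in \<open>auto simp: orbit_def intro!: clinear_onI
      simp: distrib_right h_add h_scale scaleC_mult_left scaleC_complex_def\<close>)
  show "(\<lambda>z. h (F z * \<sigma> z y)) holomorphic_on UNIV"
    using y
  proof (induction y rule: A_induct)
    case (coef n u i j)
    note uA = coef_in_A[OF coef(1)]
    show ?case
      unfolding modular_coef[OF coef] sum_distrib_left h_sum scaleC_mult_right h_scale using coef
      by (intro holomorphic_intros f_holomorphic_compose hol) (auto intro: uA)
  next
    case (add x y)
    then show ?case
      by (simp add: clinear_on_add[OF modular_clinear] distrib_left h_add holomorphic_on_add)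
  next
    case (scale c x)
    then show ?case
      by (simp add: clinear_on_scale[OF modular_clinear] scaleC_mult_right h_scale holomorphic_intros)
  qed
next
  fix s :: real
  obtain x where x: "\<And>n. x n \<in> A" "x \<longlonglongrightarrow> F 0"
    "(\<lambda>n. \<sigma> (of_real s) (x n)) \<longlonglongrightarrow> F (of_real s)"
    using orbit_sequence[OF F] by blast
  \<comment> \<open>On approximants from \<open>A\<close> the claim is multiplicativity of \<sigma>
    and invariance of \<open>h\<close>; the limit uses convergence in the closed graph.\<close>
  have "h (\<sigma> (of_real s) (x n) * \<sigma> (of_real s) y) = h (x n * y)" for n
    using x(1) y by (simp flip: modular_mult add: haar_modular mult_in_A)
  moreover have "(\<lambda>n. h (\<sigma> (of_real s) (x n) * \<sigma> (of_real s) y)) \<longlonglongrightarrow>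
      h (F (of_real s) * \<sigma> (of_real s) y)" "(\<lambda>n. h (x n * y)) \<longlonglongrightarrow> h (F 0 * y)"
    by (intro bounded_linear.tendsto[OF h_bounded] tendsto_intros x)+
  ultimately show "h (F (of_real s) * \<sigma> (of_real s) y) = h (F 0 * y)"
    using LIMSEQ_unique by simp
qed auto

text \<open>Half of the modular translation is moved onto \<open>y\<close> and the KMS property
  turns the order around. Cauchy-Schwarz then applies with a factor whose weight under
  \<open>h\<close> is that of \<open>y\<close> itself. The constant is the same for all
  orbits.\<close>

lemma haar_orbit_bound:
  obtains C where "\<And>F x. orbit F \<Longrightarrow> cmod (h (F (\<i>/2) * x)) \<le> C * norm (F 0) * norm x"
proof -
  obtain C where C: "0 < C" "\<And>x. cmod (h x) \<le> norm x * C"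
    using bounded_linear.pos_bounded[OF h_bounded] by blast
  have pos: "Re (h (star x * x)) \<le> C * (norm x)\<^sup>2" for x
    using C(2)[of "star x * x"] complex_Re_le_cmod[of "h (star x * x)"]
    by (simp add: cstar_identity mult.commute)
  \<comment> \<open>The case \<open>F 0 = 0\<close> is separate because
    \<open>haar_cauchy_schwarz\<close> asks for a positive bound.\<close>
  have A: "cmod (h (F (\<i>/2) * y)) \<le> C * norm (F 0) * norm y" if F: "orbit F" and y: "y \<in> A" for F y
  proof (cases "F 0 = 0")
    case True
    have "h (F (\<i>/2) * y) = h (F 0 * \<sigma> (- \<i>/2) y)"
      using haar_orbit[OF F modular_in_A[OF y], of "\<i>/2" "- \<i>/2"] y
      by (simp add: modular_modular modular_0)
    then show ?thesis using True by (simp add: h_zero)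
  next
    case False
    let ?p = "\<sigma> (\<i>/2) y"
    have "h (F (\<i>/2) * y) = h (F 0 * \<sigma> (- \<i>/2) y)"
      using haar_orbit[OF F modular_in_A[OF y], of "\<i>/2" "- \<i>/2"] y
      by (simp add: modular_modular modular_0)
    also have "\<dots> = h (?p * F 0)"
      using haar_kms_dense[OF modular_in_A[OF y], of "\<i>/2" "F 0"] y by (simp add: modular_modular)
    finally have eq: "h (F (\<i>/2) * y) = h (?p * F 0)" .
    \<comment> \<open>This removes the unbounded map \<open>\<sigma> (\<i>/2)\<close> from the
      estimate: the two half translations combine to \<open>\<sigma> (- \<i>)\<close>, which the KMS
      property absorbs.\<close>
    have "h (?p * star ?p) = h (?p * \<sigma> (- \<i>/2) (star y))"
      using y by (simp add: modular_star)
    also have "\<dots> = h (y * \<sigma> (- \<i>) (star y))"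
      using y by (simp add: haar_modular_adjoint modular_in_A modular_modular star_in_A)
    also have "\<dots> = h (star y * y)"
      using y by (simp add: haar_kms[of "star y" y] star_in_A)
    finally have p: "h (?p * star ?p) = h (star y * y)" .
    have "(cmod (h (?p * F 0)))\<^sup>2 \<le> Re (h (?p * star ?p)) * (C * (norm (F 0))\<^sup>2)"
      using False C(1) by (intro haar_cauchy_schwarz pos) simp
    also have "\<dots> \<le> (C * (norm y)\<^sup>2) * (C * (norm (F 0))\<^sup>2)"
      unfolding p using C(1) by (intro mult_right_mono pos) simp
    also have "\<dots> = (C * norm (F 0) * norm y)\<^sup>2"
      by (simp add: power_mult_distrib power2_eq_square)
    finally have sq: "(cmod (h (?p * F 0)))\<^sup>2 \<le> (C * norm (F 0) * norm y)\<^sup>2" .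
    show ?thesis
      unfolding eq by (rule power2_le_imp_le[OF sq]) (use C(1) in simp)
  qed
  have "cmod (h (F (\<i>/2) * x)) \<le> C * norm (F 0) * norm x" if F: "orbit F" for F x
  proof -
    have "closure A \<subseteq> {x. cmod (h (F (\<i>/2) * x)) \<le> C * norm (F 0) * norm x}"
      using A[OF F] by (intro closure_minimal closed_Collect_le continuous_intros continuous_on_haar) auto
    then show ?thesis using dense by blast
  qed
  then show thesis by (rule that)
qed

section \<open>Transfer of KMS symmetry to the Hopf algebra\<close>

text \<open>At \<open>s = 0\<close> the graph lies in the diagonal, which is closed; this pins down
  \<open>\<tau> 0\<close>.\<close>

lemma modular_subalgebra_orbit:
  assumes B: "modular_subalgebra G f B \<tau>" and b: "b \<in> B"
  shows "\<tau> 0 b = b" "orbit (\<lambda>z. \<tau> z b)"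
proof -
  have *: "entire_curve (\<lambda>z. \<tau> z b)"
    "(b, \<tau> (of_real s) b) \<in> closure {(x, \<sigma> (of_real s) x) | x. x \<in> A}" for s :: real
    using B b unfolding modular_subalgebra_def by blast+
  have "closure {(x, \<sigma> (of_real 0) x) | x. x \<in> A} \<subseteq> {p. fst p = snd p}"
    by (intro closure_minimal closed_Collect_eq continuous_intros) (auto simp: modular_0)
  with *(2)[of 0] show 0: "\<tau> 0 b = b"
    by auto
  show "orbit (\<lambda>z. \<tau> z b)"
    using * by (simp add: orbit_def 0)
qed

text \<open>The arguments are exchanged one at a time: first \<open>b\<close> is approximated from
  \<open>B\<close>, with the error controlled by \<open>haar_orbit_bound\<close>, then
  \<open>a\<close>, after all operators have been moved away from it.\<close>

lemma KMS_symmetric_imp_on_hopf_alg: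
  assumes P: "clinear_on UNIV P" "\<And>x. norm (P x) \<le> norm x" "\<And>a. a \<in> A \<Longrightarrow> P a = lconv G \<psi> a"
    and \<psi>: "lin \<psi>" and sym: "KMS_symmetric G f h P" and ab: "a \<in> A" "b \<in> A"
  shows "h (a * P b) = h (\<sigma> (\<i>/2) b * P (\<sigma> (- \<i>/2) a))"
proof -
  obtain B \<tau> where B: "modular_subalgebra G f B \<tau>" "closure B = UNIV"
    and kms: "\<And>a b. a \<in> B \<Longrightarrow> b \<in> B \<Longrightarrow> h (a * P b) = h (\<tau> (\<i>/2) b * P (\<tau> (- \<i>/2) a))"
    using sym unfolding KMS_symmetric_def by blast
  have bl: "bounded_linear P"
    using P(2) clinear_imp_linear[OF P(1)]
    by (intro bounded_linear_intro[of P 1]) (auto simp: linear_add linear_scale)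
  obtain C where C: "\<And>F x. orbit F \<Longrightarrow> cmod (h (F (\<i>/2) * x)) \<le> C * norm (F 0) * norm x"
    using haar_orbit_bound by blast
  note tendsto_h = bounded_linear.tendsto[OF h_bounded]
  \<comment> \<open>With \<open>c\<close> fixed, \<open>P (\<tau> (- \<i>/2) c)\<close> is a fixed
    vector, so only the orbit in the left factor varies, and its difference from the orbit of
    \<open>b\<close> has the small initial value \<open>x n - b\<close>.\<close>
  have 1: "h (c * P b) = h (\<sigma> (\<i>/2) b * P (\<tau> (- \<i>/2) c))" if c: "c \<in> B" for c
  proof -
    let ?Y = "P (\<tau> (- \<i>/2) c)"
    obtain x where x: "\<And>n. x n \<in> B" "x \<longlonglongrightarrow> b"
      using B(2) closure_sequential[of b B] by auto
    have "norm (h (c * P (x n)) - h (\<sigma> (\<i>/2) b * ?Y)) \<le> C * norm (x n - b) * norm ?Y" for n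
    proof -
      have "h (c * P (x n)) - h (\<sigma> (\<i>/2) b * ?Y) = h ((\<tau> (\<i>/2) (x n) - \<sigma> (\<i>/2) b) * ?Y)"
        unfolding kms[OF c x(1)] left_diff_distrib h_diff ..
      also have "cmod \<dots> \<le> C * norm (\<tau> 0 (x n) - \<sigma> 0 b) * norm ?Y"
        by (rule C[OF orbit_diff[OF modular_subalgebra_orbit(2)[OF B(1) x(1)] orbit_modular[OF ab(2)]]])
      finally show ?thesis
        unfolding modular_subalgebra_orbit(1)[OF B(1) x(1)] modular_0[OF ab(2)] .
    qed
    then have le: "\<forall>n. norm (h (c * P (x n)) - h (\<sigma> (\<i>/2) b * ?Y)) \<le> C * norm (x n - b) * norm ?Y" ..
    have "(\<lambda>n. C * norm (x n - b) * norm ?Y) \<longlonglongrightarrow> 0"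
      by (intro tendsto_mult_left_zero tendsto_mult_right_zero tendsto_norm_zero LIM_zero x)
    then have "(\<lambda>n. h (c * P (x n)) - h (\<sigma> (\<i>/2) b * ?Y)) \<longlonglongrightarrow> 0"
      by (rule Lim_null_comparison[OF always_eventually[OF le]])
    then have "(\<lambda>n. h (c * P (x n))) \<longlonglongrightarrow> h (\<sigma> (\<i>/2) b * ?Y)"
      by (rule LIM_zero_cancel)
    moreover have "(\<lambda>n. h (c * P (x n))) \<longlonglongrightarrow> h (c * P b)"
      using x(2) by (intro tendsto_h tendsto_intros bounded_linear.tendsto[OF bl])
    ultimately show ?thesis
      using LIMSEQ_unique by blast
  qed
  \<comment> \<open>\<open>y\<close> represents the functional sending \<open>w\<close> to
    \<open>h (\<sigma> (\<i>/2) b * P w)\<close>: the KMS property moves the left factor to the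
    right, and strong invariance moves \<open>P\<close> onto it.\<close>
  define y where "y = lconv G (\<lambda>x. \<psi> (S x)) (\<sigma> (- \<i>) (\<sigma> (\<i>/2) b))"
  have y: "y \<in> A"
    unfolding y_def using ab by (intro lconv_in_A S_lin \<psi> modular_in_A)
  have adj: "h (\<sigma> (\<i>/2) b * P w) = h (w * y)" for w
  proof -
    have "h (\<sigma> (\<i>/2) b * P w) = h (P w * \<sigma> (- \<i>) (\<sigma> (\<i>/2) b))"
      using ab by (intro haar_kms_dense modular_in_A)
    also have "\<dots> = h (w * y)"
    proof (rule dense_eqI[where F = "\<lambda>w. h (P w * \<sigma> (- \<i>) (\<sigma> (\<i>/2) b))"])
      fix w assume "w \<in> A"
      then show "h (P w * \<sigma> (- \<i>) (\<sigma> (\<i>/2) b)) = h (w * y)"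
        unfolding y_def using ab by (simp add: P(3) haar_strong_invariance \<psi> modular_in_A)
    qed (intro continuous_on_haar continuous_intros bounded_linear.continuous_on[OF bl])+
    finally show ?thesis .
  qed
  \<comment> \<open>After this shift the orbit enters only through \<open>F 0\<close>, so norm
    convergence of \<open>x n\<close> to \<open>a\<close> suffices for the second
    approximation.\<close>
  have shift: "h (F (- \<i>/2) * y) = h (F 0 * \<sigma> (\<i>/2) y)" if "orbit F" for F
    using haar_orbit[OF that modular_in_A[OF y], of "- \<i>/2" "\<i>/2"] y
    by (simp add: modular_modular modular_0)
  obtain x where x: "\<And>n. x n \<in> B" "x \<longlonglongrightarrow> a"
    using B(2) closure_sequential[of a B] by auto
  have "h (x n * P b) = h (x n * \<sigma> (\<i>/2) y)" for n
    using 1[OF x(1)] shift[OF modular_subalgebra_orbit(2)[OF B(1) x(1)]]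
    by (simp add: adj modular_subalgebra_orbit(1)[OF B(1) x(1)])
  moreover have "(\<lambda>n. h (x n * P b)) \<longlonglongrightarrow> h (a * P b)"
    "(\<lambda>n. h (x n * \<sigma> (\<i>/2) y)) \<longlonglongrightarrow> h (a * \<sigma> (\<i>/2) y)"
    using x(2) by (intro tendsto_h tendsto_intros; assumption)+
  ultimately have "h (a * P b) = h (a * \<sigma> (\<i>/2) y)"
    using LIMSEQ_unique by simp
  also have "\<dots> = h (\<sigma> (- \<i>/2) a * y)"
    using shift[OF orbit_modular[OF ab(1)]] ab by (simp add: modular_0)
  also have "\<dots> = h (\<sigma> (\<i>/2) b * P (\<sigma> (- \<i>/2) a))"
    by (simp add: adj)
  finally show ?thesis .
qed

lemma modular_subalgebra_hopf_alg: "modular_subalgebra G f A \<sigma>"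
  using orbit_modular unfolding modular_subalgebra_def star_subalgebra_def orbit_def
  by (auto simp: A_add A_scale mult_in_A star_in_A modular_in_A modular_0 cvs.subspace_0[OF A_sub])

text \<open>The Hopf algebra is itself an admissible choice of \<open>B\<close>, so the existential
  statement is equivalent to the symmetry on \<open>A\<close>.\<close>

lemma KMS_symmetric_iff:
  assumes P: "clinear_on UNIV P" "\<And>x. norm (P x) \<le> norm x" "\<And>a. a \<in> A \<Longrightarrow> P a = lconv G \<psi> a"
    and \<psi>: "lin \<psi>"
  shows "KMS_symmetric G f h P \<longleftrightarrow> (\<forall>a\<in>A. \<psi> (R a) = \<psi> a)"
proof -
  have "KMS_symmetric G f h P \<longleftrightarrow>
      (\<forall>a\<in>A. \<forall>b\<in>A. h (a * P b) = h (\<sigma> (\<i>/2) b * P (\<sigma> (- \<i>/2) a)))"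
    using KMS_symmetric_imp_on_hopf_alg[OF P \<psi>] modular_subalgebra_hopf_alg dense
    unfolding KMS_symmetric_def by blast
  then show ?thesis
    by (simp add: P(3) modular_in_A haar_kms_symmetric_shift \<psi> haar_kms_symmetric_iff
        del: divide_minus_left minus_divide_left)
qed

end

section \<open>Equivalence of the symmetry conditions\<close>

theorem theorem4p11:
  fixes G :: "('a::unital_cstar_algebra, 'c::unital_cstar_algebra, 'd::unital_cstar_algebra)
                quantum_group"
    and \<epsilon> :: "'a \<Rightarrow> complex" and S :: "'a \<Rightarrow> 'a" and h :: "'a \<Rightarrow> complex"
    and f :: "complex \<Rightarrow> 'a \<Rightarrow> complex"
    and \<phi> :: "'a \<Rightarrow> complex" and T :: "real \<Rightarrow> 'a \<Rightarrow> 'a"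
  assumes "compact_quantum_group G"
    and "is_counit G \<epsilon>" and "is_antipode G \<epsilon> S" and "haar_state G h"
    and "is_reduced_cstar G h \<or> is_universal_cstar G"
    and "woronowicz_characters G \<epsilon> S h f"
    and "generating_functional G \<epsilon> \<phi>"
    and "markov_semigroup G \<epsilon> \<phi> T"
  shows
   "(let A = hopf_alg G; L = lconv G \<phi>; \<sigma> = modular G f; R = unitary_antipode G S f;
         a1 = (\<forall>a\<in>A. \<phi> (R a) = \<phi> a);
         a2 = (\<forall>a\<in>A. \<forall>b\<in>A. h (star (\<sigma> (- \<i> / 2) a) * L b) = h (star (L a) * \<sigma> (- \<i> / 2) b));
         a3 = (\<forall>t\<ge>0. KMS_symmetric G f h (T t));
         b1 = (\<forall>a\<in>A. \<phi> (S a) = \<phi> a);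
         b2 = (\<forall>a\<in>A. \<forall>b\<in>A. h (star a * L b) = h (star (L a) * b));
         b2' = (\<forall>a\<in>A. \<forall>b\<in>A. h (a * L b) = h (L a * b));
         b3 = (\<forall>t\<ge>0. \<forall>a\<in>A. \<forall>b\<in>A. h (a * T t b) = h (T t a * b))
     in (a1 \<longleftrightarrow> a2) \<and> (a2 \<longleftrightarrow> a3) \<and> (b1 \<longleftrightarrow> b2) \<and> (b2 \<longleftrightarrow> b2') \<and> (b2' \<longleftrightarrow> b3))"
proof -
  have "closure (hopf_alg G) = UNIV"
    using assms(5) by (auto simp: is_reduced_cstar_def is_universal_cstar_def)
  then interpret woronowicz_cqg G \<epsilon> S h f
    using assms by unfold_locales
  have \<phi>: "lin \<phi>" "\<And>a. a \<in> A \<Longrightarrow> \<phi> (star a) = cnj (\<phi> a)"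
    using assms(7) by (auto simp: generating_functional_def)
  \<comment> \<open>\<phi> is hermitian, so it equals its conjugate functional from
    \<open>lconv_star\<close> on \<open>A\<close>.\<close>
  have L_star: "star (lconv G \<phi> a) = lconv G \<phi> (star a)" if a: "a \<in> A" for a
    unfolding lconv_star[OF \<phi>(1) a]
    by (rule lconv_cong) (auto simp: \<phi> lin_star star_in_A a)
  \<comment> \<open>\<open>star\<close> maps \<open>A\<close> onto itself, so it may be dropped from
    a universally quantified argument.\<close>
  have all_star: "(\<forall>a\<in>A. Q (star a)) \<longleftrightarrow> (\<forall>a\<in>A. Q a)" for Q :: "'a \<Rightarrow> bool"
    using star_in_A star_star by metis
  have T: "clinear_on UNIV (T t)" "norm (T t x) \<le> norm x"
    "a \<in> A \<Longrightarrow> T t a = lconv G (conv_exp G \<epsilon> \<phi> t) a" if "0 \<le> t" for t x a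
    using assms(8) that by (auto simp: markov_semigroup_def completely_positive_def)
  note \<phi>t = conv_exp_lin[OF \<phi>(1)]
  let ?a1 = "\<forall>a\<in>A. \<phi> (R a) = \<phi> a"
  let ?b1 = "\<forall>a\<in>A. \<phi> (S a) = \<phi> a"
  \<comment> \<open>\<open>modular_star\<close> turns the star of
    \<open>\<sigma> (- \<i>/2) a\<close> into \<open>\<sigma> (\<i>/2)\<close> applied to
    \<open>star a\<close>.\<close>
  have a2: "(\<forall>a\<in>A. \<forall>b\<in>A. h (star (\<sigma> (- \<i>/2) a) * lconv G \<phi> b) =
      h (star (lconv G \<phi> a) * \<sigma> (- \<i>/2) b)) \<longleftrightarrow> ?a1"
    using all_star[of "\<lambda>a. \<forall>b\<in>A. h (\<sigma> (\<i>/2) a * lconv G \<phi> b) = h (lconv G \<phi> a * \<sigma> (- \<i>/2) b)"]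
    by (simp add: L_star modular_star haar_kms_symmetric_iff[OF \<phi>(1), symmetric])
  \<comment> \<open>For each time the criterion is applied to the functional
    \<open>conv_exp\<close>; the exponential lemma then returns to \<phi>.\<close>
  have a3: "(\<forall>t\<ge>0. KMS_symmetric G f h (T t)) \<longleftrightarrow> ?a1"
    using KMS_symmetric_iff[OF T \<phi>t] conv_exp_reverse_iff[OF \<phi>(1) reverses_conv_unitary_antipode]
    by auto
  have b2': "(\<forall>a\<in>A. \<forall>b\<in>A. h (a * lconv G \<phi> b) = h (lconv G \<phi> a * b)) \<longleftrightarrow> ?b1"
    by (rule haar_symmetric_iff[OF \<phi>(1)])
  have b2: "(\<forall>a\<in>A. \<forall>b\<in>A. h (star a * lconv G \<phi> b) = h (star (lconv G \<phi> a) * b)) \<longleftrightarrow> ?b1"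
    using all_star[of "\<lambda>a. \<forall>b\<in>A. h (a * lconv G \<phi> b) = h (lconv G \<phi> a * b)"] b2'
    by (simp add: L_star)
  \<comment> \<open>At a fixed time, detailed balance is the criterion of
    \<open>haar_symmetric_iff\<close> for \<open>conv_exp\<close>.\<close>
  have "(\<forall>a\<in>A. \<forall>b\<in>A. h (a * T t b) = h (T t a * b)) \<longleftrightarrow>
      (\<forall>a\<in>A. conv_exp G \<epsilon> \<phi> t (S a) = conv_exp G \<epsilon> \<phi> t a)" if "0 \<le> t" for t
    using haar_symmetric_iff[OF \<phi>t] T(3)[OF that] by simp
  then have b3: "(\<forall>t\<ge>0. \<forall>a\<in>A. \<forall>b\<in>A. h (a * T t b) = h (T t a * b)) \<longleftrightarrow> ?b1"
    using conv_exp_reverse_iff[OF \<phi>(1) reverses_conv_S] by auto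
  show ?thesis
    unfolding Let_def a2 a3 b2 b2' b3 by simp
qed

end
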